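(* Let $k$ be an algebraically closed field of characteristic $\ne 2$, fix $r\ge 1$, and let $R=k[x_i,y_i,z_i\mid 1\le i\le r]$ be the coordinate ring of $\mathfrak{sl}_2^r$, where the $i$-th component of a tuple is $\begin{pmatrix} x_i & y_i \\ z_i & -x_i \end{pmatrix}$. Let $\mathcal{N}$ be the nilpotent cone of $\mathfrak{sl}_2$. For $1\le m\le r$ let $I_m\subseteq R$ be the radical ideal of the closed subvariety $0\times\cdots\times 0\times C_m(\mathcal{N})\subseteq C_r(\mathcal{N})\subseteq\mathfrak{sl}_2^r$ (the first $r-m$ components being $0$), and let $$P_m=\sum_{i=1}^m\langle x_i,y_i,z_i\rangle+\sum_{j=m+1}^r\langle x_j-y_j,\ y_j+z_j\rangle .$$ Then the family of ideals of $R$ $$\mathcal{F}=\{I_j\}_{j=1}^r\cup\{P_j\}_{j=1}^r\cup\Big\{I_r+\sum_{i=1}^m\langle y_i+z_i\rangle\Big\}_{m=1}^r\cup\Big\{I_r+\sum_{i=1}^r\langle y_i+z_i\rangle+\sum_{j=1}^n\langle x_j+y_j\rangle\Big\}_{n=1}^r\cup\{\mathfrak{m}\},$$ where $\mathfrak{m}=\langle x_1,y_1,z_1,\ldots,x_r,y_r,z_r\rangle$, is a principal radical system.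
   Context: $C_m(\mathcal{N})=\{(v_1,\ldots,v_m)\in\mathcal{N}^m\mid [v_i,v_j]=0\text{ for all } i,j\}$. A family $F$ of ideals in a Noetherian ring $A$, partially ordered by inclusion, is called a principal radical system if for every $I\in F$ one of the following holds: (a) $I$ is a radical ideal; or (b) there exists $x\in A$ such that $I+Ax\in F$ and either (i) $x$ is not a zero-divisor of $A/\sqrt{I}$ and $\bigcap_{i=0}^\infty (I+Ax^i)/I=0$, or (ii) there exists an ideal $J\in F$ with $I\subsetneq J$ such that $xJ\subseteq I$ and $x$ is not a zero-divisor of $A/\sqrt{J}$. (By a theorem of Hochster, all ideals in a principal radical system are radical.) *)

theory Defs
  imports "HOL-Analysis.Analysis" "HOL-Algebra.Algebra" "HOL-Library.Poly_Mapping"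
begin

definition radical :: "('a, 'b) ring_scheme \<Rightarrow> 'a set \<Rightarrow> 'a set" where
  "radical A I = {a \<in> carrier A. \<exists>n::nat. n > 0 \<and> a [^]\<^bsub>A\<^esub> n \<in> I}"

definition radical_ideal :: "('a, 'b) ring_scheme \<Rightarrow> 'a set \<Rightarrow> bool" where
  "radical_ideal A I \<longleftrightarrow> ideal I A \<and> radical A I = I"

definition non_zero_divisor :: "('a, 'b) ring_scheme \<Rightarrow> 'a \<Rightarrow> bool" where
  "non_zero_divisor A x \<longleftrightarrow> (\<forall>y\<in>carrier A. x \<otimes>\<^bsub>A\<^esub> y = \<zero>\<^bsub>A\<^esub> \<longrightarrow> y = \<zero>\<^bsub>A\<^esub>)"

text \<open>The residue class of \<open>x\<close> in the quotient by \<open>I\<close> is the coset \<open>I +> x\<close>. In alternative (i), the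
  ideal \<open>(I + A x^i) / I\<close> of the quotient is the image of \<open>I + A x^i\<close> under the canonical projection.\<close>

definition principal_radical_system :: "('a, 'b) ring_scheme \<Rightarrow> 'a set set \<Rightarrow> bool" where
  "principal_radical_system A F \<longleftrightarrow>
     cring A \<and> noetherian_ring A \<and> (\<forall>I\<in>F. ideal I A) \<and>
     (\<forall>I\<in>F.
        radical_ideal A I \<or>
        (\<exists>x\<in>carrier A.
           I <+>\<^bsub>A\<^esub> PIdl\<^bsub>A\<^esub> x \<in> F \<and>
           ((non_zero_divisor (A Quot (radical A I)) (radical A I +>\<^bsub>A\<^esub> x) \<and>
             (\<Inter>i::nat. (\<lambda>a. I +>\<^bsub>A\<^esub> a) ` (I <+>\<^bsub>A\<^esub> PIdl\<^bsub>A\<^esub> (x [^]\<^bsub>A\<^esub> i))) = {\<zero>\<^bsub>A Quot I\<^esub>}) \<or>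
            (\<exists>J\<in>F. I \<subset> J \<and> (\<forall>a\<in>J. x \<otimes>\<^bsub>A\<^esub> a \<in> I) \<and>
               non_zero_divisor (A Quot (radical A J)) (radical A J +>\<^bsub>A\<^esub> x)))))"

definition ideal_sum :: "('a, 'b) ring_scheme \<Rightarrow> 'i set \<Rightarrow> ('i \<Rightarrow> 'a set) \<Rightarrow> 'a set" where
  "ideal_sum A S J = Idl\<^bsub>A\<^esub> (\<Union>s\<in>S. J s)"

type_synonym 'k mat2 = "'k^2^2"

definition lie_bracket :: "'k::comm_ring_1 mat2 \<Rightarrow> 'k mat2 \<Rightarrow> 'k mat2" where
  "lie_bracket M N = M ** N - N ** M"

definition sl2 :: "'k::comm_ring_1 mat2 set" where
  "sl2 = {M. trace M = 0}"

definition nilpotent_cone :: "'k::comm_ring_1 mat2 set" where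
  "nilpotent_cone = {M \<in> sl2. \<exists>n::nat. (((**) M) ^^ n) (mat 1) = 0}"

text \<open>An \<open>m\<close>-tuple is a function on \<open>{1..m}\<close>, extended by \<open>undefined\<close>.\<close>

definition commuting_nilpotents :: "nat \<Rightarrow> (nat \<Rightarrow> 'k::comm_ring_1 mat2) set" where
  "commuting_nilpotents m =
     {v \<in> {1..m} \<rightarrow>\<^sub>E nilpotent_cone. \<forall>i\<in>{1..m}. \<forall>j\<in>{1..m}. lie_bracket (v i) (v j) = 0}"

text \<open>\<open>0 \<times> \<dots> \<times> 0 \<times> C\<^sub>m(N)\<close> with \<open>r - m\<close> leading zeros, as a set of \<open>r\<close>-tuples\<close>

definition padded_commuting_nilpotents :: "nat \<Rightarrow> nat \<Rightarrow> (nat \<Rightarrow> 'k::comm_ring_1 mat2) set" where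
  "padded_commuting_nilpotents r m =
     (\<lambda>v. \<lambda>i\<in>{1..r}. if i \<le> r - m then 0 else v (i - (r - m))) ` commuting_nilpotents m"

datatype coord = CX nat | CY nat | CZ nat

type_synonym 'k coord_poly = "(coord \<Rightarrow>\<^sub>0 nat) \<Rightarrow>\<^sub>0 'k"

definition coord_var :: "coord \<Rightarrow> 'k::comm_ring_1 coord_poly" where
  "coord_var c = Poly_Mapping.single (Poly_Mapping.single c 1) 1"

abbreviation x_var :: "nat \<Rightarrow> 'k::comm_ring_1 coord_poly" where "x_var i \<equiv> coord_var (CX i)"
abbreviation y_var :: "nat \<Rightarrow> 'k::comm_ring_1 coord_poly" where "y_var i \<equiv> coord_var (CY i)"
abbreviation z_var :: "nat \<Rightarrow> 'k::comm_ring_1 coord_poly" where "z_var i \<equiv> coord_var (CZ i)"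

definition coords :: "nat \<Rightarrow> coord set" where
  "coords r = (\<Union>i\<in>{1..r}. {CX i, CY i, CZ i})"

text \<open>The coordinate of index \<open>(1, 1)\<close>, \<open>(1, 2)\<close>, \<open>(2, 1)\<close> of the \<open>i\<close>-th matrix is \<open>CX i\<close>, \<open>CY i\<close>, \<open>CZ i\<close>;
  a polynomial maps exponent vectors to coefficients, and the ring consists of those
  polynomials that involve only the variables with index in \<open>{1..r}\<close>.\<close>

definition coord_ring :: "nat \<Rightarrow> 'k::comm_ring_1 coord_poly ring" where
  "coord_ring r =
     \<lparr>carrier = {p. \<forall>t\<in>Poly_Mapping.keys p. Poly_Mapping.keys t \<subseteq> coords r},
      monoid.mult = (*), one = 1, ring.zero = 0, add = (+)\<rparr>"

fun coord_value :: "(nat \<Rightarrow> 'k mat2) \<Rightarrow> coord \<Rightarrow> 'k" where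
  "coord_value v (CX i) = v i $ 1 $ 1"
| "coord_value v (CY i) = v i $ 1 $ 2"
| "coord_value v (CZ i) = v i $ 2 $ 1"

definition coord_eval :: "'k::comm_ring_1 coord_poly \<Rightarrow> (nat \<Rightarrow> 'k mat2) \<Rightarrow> 'k" where
  "coord_eval p v =
     (\<Sum>t\<in>Poly_Mapping.keys p. Poly_Mapping.lookup p t *
        (\<Prod>c\<in>Poly_Mapping.keys t. coord_value v c ^ Poly_Mapping.lookup t c))"

definition vanishing_ideal :: "nat \<Rightarrow> (nat \<Rightarrow> 'k::comm_ring_1 mat2) set \<Rightarrow> 'k coord_poly set" where
  "vanishing_ideal r V = {p \<in> carrier (coord_ring r). \<forall>v\<in>V. coord_eval p v = 0}"

definition I_ideal :: "nat \<Rightarrow> nat \<Rightarrow> 'k::comm_ring_1 coord_poly set" where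
  "I_ideal r m = vanishing_ideal r (padded_commuting_nilpotents r m)"

definition P_ideal :: "nat \<Rightarrow> nat \<Rightarrow> 'k::comm_ring_1 coord_poly set" where
  "P_ideal r m =
     ideal_sum (coord_ring r) {1..m}
       (\<lambda>i. Idl\<^bsub>coord_ring r\<^esub> {x_var i, y_var i, z_var i})
     <+>\<^bsub>coord_ring r\<^esub>
     ideal_sum (coord_ring r) {m+1..r}
       (\<lambda>j. Idl\<^bsub>coord_ring r\<^esub> {x_var j - y_var j, y_var j + z_var j})"

definition irrelevant_ideal :: "nat \<Rightarrow> 'k::comm_ring_1 coord_poly set" where
  "irrelevant_ideal r = Idl\<^bsub>coord_ring r\<^esub> (\<Union>i\<in>{1..r}. {x_var i, y_var i, z_var i})"

end

theory Submission
  imports Defs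
begin

text \<open>
  Pairwise commuting nilpotents in \<open>sl\<^sub>2\<close> are proportional, so \<open>C\<^sub>r(N)\<close> is parametrised by
  \<open>x\<^sub>i = s\<^sub>i a b\<close>, \<open>y\<^sub>i = s\<^sub>i a\<^sup>2\<close>, \<open>z\<^sub>i = - s\<^sub>i b\<^sup>2\<close>. The \<open>I\<^sub>j\<close>, the \<open>P\<^sub>j\<close> and \<open>m\<close> are
  vanishing ideals, hence radical. Let \<open>A\<^sub>m = I\<^sub>r + (y\<^sub>i + z\<^sub>i | i \<le> m)\<close> and
  \<open>B\<^sub>n = A\<^sub>r + (x\<^sub>j + y\<^sub>j | j \<le> n)\<close>. For \<open>m < r\<close> alternative (b)(ii) holds for \<open>A\<^sub>m\<close> with
  \<open>x = y\<^sub>m\<^sub>+\<^sub>1 + z\<^sub>m\<^sub>+\<^sub>1\<close> and \<open>J = I\<^sub>r\<^sub>-\<^sub>m\<close>, and for \<open>n < r\<close> it holds for \<open>B\<^sub>n\<close> with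
  \<open>x = x\<^sub>n\<^sub>+\<^sub>1 + y\<^sub>n\<^sub>+\<^sub>1\<close> and \<open>J = P\<^sub>n\<close>; the inclusions \<open>x J \<subseteq> A\<^sub>m\<close> and \<open>x J \<subseteq> B\<^sub>n\<close> follow from the
  quadrics \<open>x\<^sub>i y\<^sub>j - x\<^sub>j y\<^sub>i\<close>, \<open>x\<^sub>i z\<^sub>j - x\<^sub>j z\<^sub>i\<close>, \<open>y\<^sub>i z\<^sub>j - y\<^sub>j z\<^sub>i\<close>, \<open>x\<^sub>i x\<^sub>j + y\<^sub>i z\<^sub>j\<close> in \<open>I\<^sub>r\<close>.
  The ideal \<open>B\<^sub>r\<close> is generated by linear forms. For \<open>A\<^sub>r\<close> alternative (b) is not available, as the
  family has no \<open>P\<^sub>0\<close>; here radicality is direct: modulo \<open>A\<^sub>r\<close> the \<open>z\<^sub>i\<close> are eliminated and what remains is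
  \<open>(x\<^sub>i + y\<^sub>i)(x\<^sub>j - y\<^sub>j) = 0\<close> for all \<open>i, j\<close>, two linear spaces meeting in the origin.
\<close>

section \<open>Polynomials and substitution\<close>

definition const :: "'k \<Rightarrow> ('v \<Rightarrow>\<^sub>0 nat) \<Rightarrow>\<^sub>0 'k::comm_ring_1" where
  "const k = Poly_Mapping.single 0 k"

definition var :: "'v \<Rightarrow> ('v \<Rightarrow>\<^sub>0 nat) \<Rightarrow>\<^sub>0 'k::comm_ring_1" where
  "var v = Poly_Mapping.single (Poly_Mapping.single v 1) 1"

text \<open>The set of variables is a parameter, not a type, so that proofs can add one variable at
  a time.\<close>

definition polys :: "'v set \<Rightarrow> (('v \<Rightarrow>\<^sub>0 nat) \<Rightarrow>\<^sub>0 'k::comm_ring_1) set" where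
  "polys V = {p. \<forall>t\<in>Poly_Mapping.keys p. Poly_Mapping.keys t \<subseteq> V}"

lemma polys_mono: "V \<subseteq> W \<Longrightarrow> polys V \<subseteq> polys W"
  unfolding polys_def by blast

lemma const_in_polys: "const k \<in> polys V"
  by (simp add: const_def polys_def)

lemma var_in_polys: "v \<in> V \<Longrightarrow> var v \<in> polys V"
  by (simp add: var_def polys_def)

lemma const_0: "const 0 = 0" by (simp add: const_def)
lemma const_1: "const 1 = 1" by (simp add: const_def)
lemma const_add: "const (a + b) = const a + const b" by (simp add: const_def single_add)
lemma const_mult: "const (a * b) = const a * const b" by (simp add: const_def mult_single)
lemma const_uminus: "const (- a) = - const a" by (simp add: const_def single_uminus)

lemma polys_0: "0 \<in> polys V" and polys_1: "1 \<in> polys V"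
  by (simp_all add: polys_def)

lemma polys_add: "p \<in> polys V \<Longrightarrow> q \<in> polys V \<Longrightarrow> p + q \<in> polys V"
  using keys_add[of p q] unfolding polys_def by blast

lemma polys_mult:
  assumes "p \<in> polys V" "q \<in> polys V"
  shows "p * q \<in> polys V"
proof -
  have "Poly_Mapping.keys t \<subseteq> V" if "t \<in> Poly_Mapping.keys (p * q)" for t
  proof -
    have "t \<in> {a + b |a b. a \<in> Poly_Mapping.keys p \<and> b \<in> Poly_Mapping.keys q}"
      using that keys_mult[of p q] by (rule rev_subsetD)
    then obtain a b where "t = a + b" "a \<in> Poly_Mapping.keys p" "b \<in> Poly_Mapping.keys q" by blast
    then show ?thesis
      using assms keys_add[of a b] unfolding polys_def by blast
  qed
  then show ?thesis by (simp add: polys_def)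
qed

lemma polys_uminus: "p \<in> polys V \<Longrightarrow> - p \<in> polys V"
  using polys_mult[OF const_in_polys[of "-1"], of p V] by (simp add: const_uminus const_1)

lemma polys_diff: "p \<in> polys V \<Longrightarrow> q \<in> polys V \<Longrightarrow> p - q \<in> polys V"
  using polys_add[of p V "- q"] polys_uminus[of q V] by simp

lemma sum_singles: "p = (\<Sum>t\<in>Poly_Mapping.keys p. Poly_Mapping.single t (Poly_Mapping.lookup p t))"
proof (rule poly_mapping_eqI)
  fix t
  show "Poly_Mapping.lookup p t = Poly_Mapping.lookup (\<Sum>t\<in>Poly_Mapping.keys p. Poly_Mapping.single t (Poly_Mapping.lookup p t)) t"
    by (cases "t \<in> Poly_Mapping.keys p")
       (auto simp: lookup_sum lookup_single when_def sum.delta in_keys_iff)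
qed

lemma single_add_Suc:
  "Poly_Mapping.single (s + Poly_Mapping.single v (Suc n)) k
     = Poly_Mapping.single (s + Poly_Mapping.single v n) k * var v"
  unfolding var_def mult_single by (simp add: add.assoc flip: single_add)

text \<open>A polynomial is the sum of its terms, and each term arises from a constant by
  multiplying with one variable at a time.\<close>

lemma polys_induct [consumes 1, case_names const add var]:
  fixes p :: "('v \<Rightarrow>\<^sub>0 nat) \<Rightarrow>\<^sub>0 'k::comm_ring_1"
  assumes "p \<in> polys V"
    and const: "\<And>k. P (const k)"
    and add: "\<And>p q. p \<in> polys V \<Longrightarrow> q \<in> polys V \<Longrightarrow> P p \<Longrightarrow> P q \<Longrightarrow> P (p + q)"
    and var: "\<And>p v. p \<in> polys V \<Longrightarrow> v \<in> V \<Longrightarrow> P p \<Longrightarrow> P (p * var v)"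
  shows "P p"
proof -
  \<comment> \<open>The rules \<open>add\<close> and \<open>var\<close> ask for membership in
    \<open>polys V\<close>, so it is carried through the induction.\<close>
  define Q where "Q p \<longleftrightarrow> p \<in> polys V \<and> P p" for p
  have Q_single: "Q (Poly_Mapping.single (\<Sum>v\<in>A. Poly_Mapping.single v (e v)) k)"
    if "finite A" "A \<subseteq> V" for A e k
    using that
  proof (induction A rule: finite_induct)
    case empty
    then show ?case using const[of k] const_in_polys[of k V] by (simp add: Q_def const_def)
  next
    case (insert v A)
    let ?s = "\<Sum>v\<in>A. Poly_Mapping.single v (e v)"
    \<comment> \<open>For a new variable \<open>v\<close> the exponent is raised one by one; each
      rise is a multiplication by \<open>var v\<close>.\<close>
    have "Q (Poly_Mapping.single (?s + Poly_Mapping.single v n) k)" for n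
    proof (induction n)
      case 0
      then show ?case using insert by simp
    next
      case (Suc n)
      then show ?case
        unfolding single_add_Suc Q_def using insert.prems
        by (auto intro!: polys_mult var_in_polys var)
    qed
    then show ?case using insert by (simp add: add.commute)
  qed
  have Q_sum: "Q (\<Sum>t\<in>T. Poly_Mapping.single t (c t))"
    if "finite T" "\<And>t. t \<in> T \<Longrightarrow> Poly_Mapping.keys t \<subseteq> V" for T c
    using that
  proof (induction T rule: finite_induct)
    case empty
    then show ?case using const[of 0] by (simp add: Q_def const_0 polys_0)
  next
    case (insert t T)
    have "Q (Poly_Mapping.single t (c t))"
      using Q_single[of "Poly_Mapping.keys t" "Poly_Mapping.lookup t" "c t"] insert.prems
      by (simp flip: sum_singles)
    then show ?case
      using insert by (auto simp: Q_def intro: add polys_add)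
  qed
  have "Q (\<Sum>t\<in>Poly_Mapping.keys p. Poly_Mapping.single t (Poly_Mapping.lookup p t))"
    using assms(1) by (intro Q_sum) (auto simp: polys_def)
  then show ?thesis by (simp add: Q_def flip: sum_singles)
qed

section \<open>Substitution as a ring homomorphism\<close>

definition mono_value :: "('v \<Rightarrow> 'b::comm_ring_1) \<Rightarrow> ('v \<Rightarrow>\<^sub>0 nat) \<Rightarrow> 'b" where
  "mono_value \<sigma> t = (\<Prod>v\<in>Poly_Mapping.keys t. \<sigma> v ^ Poly_Mapping.lookup t v)"

text \<open>The map \<open>h\<close> on coefficients covers three uses: the identity gives
  evaluation at a point, \<open>const\<close> gives substitution of polynomials, and constant
  univariate polynomials give restriction to a curve.\<close>

definition subst ::
    "('k::comm_ring_1 \<Rightarrow> 'b::comm_ring_1) \<Rightarrow> ('v \<Rightarrow> 'b) \<Rightarrow> (('v \<Rightarrow>\<^sub>0 nat) \<Rightarrow>\<^sub>0 'k) \<Rightarrow> 'b" where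
  "subst h \<sigma> p = (\<Sum>t\<in>Poly_Mapping.keys p. h (Poly_Mapping.lookup p t) * mono_value \<sigma> t)"

lemma mono_value_add: "mono_value \<sigma> (s + t) = mono_value \<sigma> s * mono_value \<sigma> t"
proof -
  have superset: "mono_value \<sigma> u = (\<Prod>v\<in>Poly_Mapping.keys s \<union> Poly_Mapping.keys t. \<sigma> v ^ Poly_Mapping.lookup u v)"
    if "Poly_Mapping.keys u \<subseteq> Poly_Mapping.keys s \<union> Poly_Mapping.keys t" for u
    unfolding mono_value_def using that
    by (intro prod.mono_neutral_left) (auto simp: in_keys_iff)
  show ?thesis
    unfolding superset[OF keys_add] superset[OF Un_upper1] superset[OF Un_upper2]
    by (simp add: lookup_add power_add prod.distrib)
qed

locale coeff_hom =
  fixes h :: "'k::comm_ring_1 \<Rightarrow> 'b::comm_ring_1"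
  assumes hom_0: "h 0 = 0" and hom_1: "h 1 = 1"
    and hom_add: "h (a + b) = h a + h b" and hom_mult: "h (a * b) = h a * h b"
begin

lemma hom_sum: "h (\<Sum>x\<in>A. f x) = (\<Sum>x\<in>A. h (f x))"
  by (induction A rule: infinite_finite_induct) (auto simp: hom_0 hom_add)

lemma hom_prod: "h (\<Prod>x\<in>A. f x) = (\<Prod>x\<in>A. h (f x))"
  by (induction A rule: infinite_finite_induct) (auto simp: hom_1 hom_mult)

lemma hom_power: "h (a ^ n) = h a ^ n"
  by (induction n) (auto simp: hom_1 hom_mult)

lemma hom_subst: "h (subst g \<sigma> p) = subst (\<lambda>x. h (g x)) (\<lambda>v. h (\<sigma> v)) p"
  by (simp add: subst_def mono_value_def hom_sum hom_mult hom_prod hom_power)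

text \<open>Cancellation can shrink the keys of a sum, so additivity is proved by summing over a
  common finite superset.\<close>

lemma subst_superset:
  assumes "finite T" "Poly_Mapping.keys p \<subseteq> T"
  shows "subst h \<sigma> p = (\<Sum>t\<in>T. h (Poly_Mapping.lookup p t) * mono_value \<sigma> t)"
  unfolding subst_def using assms
  by (intro sum.mono_neutral_left) (auto simp: in_keys_iff hom_0)

lemma subst_add: "subst h \<sigma> (p + q) = subst h \<sigma> p + subst h \<sigma> q"
proof -
  have "finite (Poly_Mapping.keys p \<union> Poly_Mapping.keys q)" by simp
  note superset = subst_superset[OF this]
  show ?thesis
    unfolding superset[OF keys_add] superset[OF Un_upper1] superset[OF Un_upper2]
    by (simp add: lookup_add hom_add algebra_simps sum.distrib)
qed

lemma subst_0: "subst h \<sigma> 0 = 0"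
  by (simp add: subst_def)

lemma subst_sum: "subst h \<sigma> (\<Sum>x\<in>A. f x) = (\<Sum>x\<in>A. subst h \<sigma> (f x))"
  by (induction A rule: infinite_finite_induct) (auto simp: subst_0 subst_add)

lemma subst_single: "subst h \<sigma> (Poly_Mapping.single t k) = h k * mono_value \<sigma> t"
  by (subst subst_superset[of "{t}"]) auto

lemma subst_mult: "subst h \<sigma> (p * q) = subst h \<sigma> p * subst h \<sigma> q"
proof -
  let ?S = "\<lambda>p t. Poly_Mapping.single t (Poly_Mapping.lookup p t)"
  have "p * q = (\<Sum>t\<in>Poly_Mapping.keys p. \<Sum>u\<in>Poly_Mapping.keys q. ?S p t * ?S q u)"
    using sum_singles[of p] sum_singles[of q] by (metis (no_types) sum_product)
  then have "subst h \<sigma> (p * q) = (\<Sum>t\<in>Poly_Mapping.keys p. \<Sum>u\<in>Poly_Mapping.keys q.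
      (h (Poly_Mapping.lookup p t) * mono_value \<sigma> t) * (h (Poly_Mapping.lookup q u) * mono_value \<sigma> u))"
    by (simp add: subst_sum mult_single subst_single hom_mult mono_value_add algebra_simps)
  then show ?thesis by (simp add: subst_def sum_product)
qed

lemma subst_const: "subst h \<sigma> (const k) = h k"
  by (simp add: const_def subst_single mono_value_def)

lemma subst_var: "subst h \<sigma> (var v) = \<sigma> v"
  by (simp add: var_def subst_single mono_value_def hom_1)

lemma subst_1: "subst h \<sigma> 1 = 1"
  using subst_const[of \<sigma> 1] by (simp add: const_1 hom_1)

lemma subst_uminus: "subst h \<sigma> (- p) = - subst h \<sigma> p"
  using subst_add[of \<sigma> p "- p"] by (simp add: subst_0 add_eq_0_iff)

lemma subst_diff: "subst h \<sigma> (p - q) = subst h \<sigma> p - subst h \<sigma> q"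
  using subst_add[of \<sigma> p "- q"] by (simp add: subst_uminus)

lemma subst_power: "subst h \<sigma> (p ^ n) = subst h \<sigma> p ^ n"
  by (induction n) (auto simp: subst_1 subst_mult)

lemmas subst_simps =
  subst_0 subst_1 subst_const subst_var subst_add subst_uminus subst_diff subst_mult subst_power

end

lemma subst_cong:
  assumes "p \<in> polys V" "\<And>v. v \<in> V \<Longrightarrow> \<sigma> v = \<tau> v"
  shows "subst h \<sigma> p = subst h \<tau> p"
proof -
  have "\<sigma> v = \<tau> v" if "t \<in> Poly_Mapping.keys p" "v \<in> Poly_Mapping.keys t" for t v
    using assms that unfolding polys_def by blast
  then show ?thesis unfolding subst_def mono_value_def by simp
qed

interpretation id_hom: coeff_hom "\<lambda>x::'k::comm_ring_1. x"
  by unfold_locales auto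

interpretation const_hom: coeff_hom "const :: 'k::comm_ring_1 \<Rightarrow> ('v \<Rightarrow>\<^sub>0 nat) \<Rightarrow>\<^sub>0 'k"
  by unfold_locales (auto simp: const_0 const_1 const_add const_mult)

interpretation pCons_hom: coeff_hom "\<lambda>x::'k::comm_ring_1. [:x:]"
  by unfold_locales (auto simp: one_pCons)

abbreviation ev :: "('v \<Rightarrow> 'k) \<Rightarrow> (('v \<Rightarrow>\<^sub>0 nat) \<Rightarrow>\<^sub>0 'k::comm_ring_1) \<Rightarrow> 'k" where
  "ev \<equiv> subst (\<lambda>x. x)"

text \<open>Evaluation is a ring homomorphism, hence passes through a substitution. Read
  geometrically, \<open>subst const\<close> pulls a function back along a polynomial map.\<close>

lemma ev_subst: "ev w (subst const \<sigma> p) = ev (\<lambda>v. ev w (\<sigma> v)) p"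
proof -
  interpret E: coeff_hom "ev w"
    by unfold_locales (auto simp: id_hom.subst_simps)
  show ?thesis by (simp add: E.hom_subst id_hom.subst_simps)
qed

lemma poly_subst: "poly (subst (\<lambda>x. [:x:]) \<sigma> p) t = ev (\<lambda>v. poly (\<sigma> v) t) p"
proof -
  interpret E: coeff_hom "\<lambda>q. poly q t"
    by unfold_locales auto
  show ?thesis by (simp add: E.hom_subst)
qed

lemma subst_in_polys:
  assumes "p \<in> polys V" "\<And>v. v \<in> V \<Longrightarrow> \<sigma> v \<in> polys W"
  shows "subst const \<sigma> p \<in> polys W"
  using assms(1)
  by (induction p rule: polys_induct)
     (auto simp: const_hom.subst_simps const_in_polys intro: polys_add polys_mult assms(2))

text \<open>Isolates the variable \<open>v\<close>, with coefficients free of it when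
  \<open>v\<close> is new. Both the identity principle and the induction for Hilbert's theorem use
  this form.\<close>

lemma polys_insertE:
  assumes "p \<in> polys (insert v V)"
  obtains n :: nat and a where "\<And>i. a i \<in> polys V" "p = (\<Sum>i<n. a i * var v ^ i)"
proof -
  have "\<exists>n::nat. \<exists>a. (\<forall>i. a i \<in> polys V) \<and> p = (\<Sum>i<n. a i * var v ^ i)"
    using assms
  proof (induction p rule: polys_induct)
    case (const k)
    show ?case
      by (rule exI[of _ 1], rule exI[of _ "\<lambda>_. const k"]) (simp add: const_in_polys)
  next
    case (add p q)
    then obtain n m :: nat and a b where
      a: "\<forall>i. a i \<in> polys V" "p = (\<Sum>i<n. a i * var v ^ i)" and
      b: "\<forall>i. b i \<in> polys V" "q = (\<Sum>i<m. b i * var v ^ i)" by blast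
    \<comment> \<open>Zero coefficients pad both expansions to the common length
      \<open>n + m\<close>.\<close>
    have ext: "(\<Sum>i<n. a i * var v ^ i) = (\<Sum>i<n+m. (if i < n then a i else 0) * var v ^ i)"
      for n m :: nat and a :: "nat \<Rightarrow> ('a \<Rightarrow>\<^sub>0 nat) \<Rightarrow>\<^sub>0 'b"
      by (intro sum.mono_neutral_cong_left) auto
    have "p + q = (\<Sum>i<n+m. ((if i < n then a i else 0) + (if i < m then b i else 0)) * var v ^ i)"
      unfolding a b ext[where n=n and m=m] ext[where n=m and m=n] add.commute[of m n]
      by (simp add: ring_distribs sum.distrib del: mult_eq_if)
    moreover have "(if i < n then a i else 0) + (if i < m then b i else 0) \<in> polys V" for i
      using a(1) b(1) by (auto intro: polys_add polys_0)
    ultimately show ?case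
      by (intro exI[of _ "n + m"]
          exI[of _ "\<lambda>i. (if i < n then a i else 0) + (if i < m then b i else 0)"]) blast
  next
    case (var p u)
    then obtain n :: nat and a where a: "\<forall>i. a i \<in> polys V" "p = (\<Sum>i<n. a i * var v ^ i)"
      by blast
    show ?case
    \<comment> \<open>Multiplication by \<open>v\<close> itself shifts the coefficients by one
      place; any other variable lies in \<open>V\<close> and is absorbed into them.\<close>
    proof (cases "u = v")
      case True
      have "p * var u = (\<Sum>i<Suc n. (if i = 0 then 0 else a (i - 1)) * var v ^ i)"
        unfolding a(2) True sum.lessThan_Suc_shift by (simp add: sum_distrib_left mult_ac)
      moreover have "(if i = 0 then 0 else a (i - 1)) \<in> polys V" for i
        using a(1) by (auto intro: polys_0)
      ultimately show ?thesis
        by (intro exI[of _ "Suc n"] exI[of _ "\<lambda>i. if i = 0 then 0 else a (i - 1)"]) blast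
    next
      case False
      have "p * var u = (\<Sum>i<n. (a i * var u) * var v ^ i)"
        unfolding a(2) by (simp add: sum_distrib_left mult_ac)
      moreover have "a i * var u \<in> polys V" for i
        using a(1) var(2) False by (auto intro: polys_mult var_in_polys)
      ultimately show ?thesis
        by (intro exI[of _ n] exI[of _ "\<lambda>i. a i * var u"]) blast
    qed
  qed
  then show ?thesis using that by blast
qed

section \<open>The identity principle over infinite fields\<close>

lemma infinite_UNIV_alg_closed: "infinite (UNIV :: 'k::alg_closed_field set)"
proof
  assume fin: "finite (UNIV :: 'k set)"
  \<comment> \<open>As in Euclid's argument: \<open>p\<close> vanishes at every element, so
    \<open>p + 1\<close> has positive degree and no root.\<close>
  define p :: "'k poly" where "p = (\<Prod>a\<in>UNIV. [:- a, 1:])"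
  have "Polynomial.degree p = card (UNIV :: 'k set)"
    unfolding p_def using Polynomial.degree_prod_eq_sum_degree[of UNIV "\<lambda>a::'k. [:- a, 1:]"] by simp
  then have "Polynomial.degree (p + 1) > 0"
    using fin by (simp add: degree_add_eq_left finite_UNIV_card_ge_0)
  then obtain x where "poly (p + 1) x = 0"
    using alg_closed_imp_poly_has_root by blast
  moreover have "poly p x = 0"
    unfolding p_def poly_prod using fin by (intro prod_zero) (auto intro!: bexI[of _ x])
  ultimately show False by simp
qed

lemma poly_everywhere_0:
  fixes p :: "'k::idom poly"
  assumes "infinite (UNIV :: 'k set)" "\<And>t. poly p t = 0"
  shows "p = 0"
  using poly_roots_finite[of p] assms by auto

text \<open>With the other variables fixed, a univariate polynomial with infinitely many roots
  remains. Its coefficients therefore vanish at every point, and the induction hypothesis applies to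
  them.\<close>

lemma ev_everywhere_0:
  fixes p :: "('v \<Rightarrow>\<^sub>0 nat) \<Rightarrow>\<^sub>0 'k::idom"
  assumes inf: "infinite (UNIV :: 'k set)" and "finite V" "p \<in> polys V" "\<And>w. ev w p = 0"
  shows "p = 0"
  using assms(2-)
proof (induction V arbitrary: p rule: finite_induct)
  case empty
  then have "p = const (Poly_Mapping.lookup p 0)"
    by (intro poly_mapping_eqI) (auto simp: const_def polys_def lookup_single when_def in_keys_iff)
  then show ?case
    using empty.prems(2)[of "\<lambda>_. 0"] by (metis const_0 id_hom.subst_const)
next
  case (insert v V)
  obtain n :: nat and a where a: "\<And>i. a i \<in> polys V" "p = (\<Sum>i<n. a i * var v ^ i)"
    using insert.prems(1) by (rule polys_insertE) blast
  have "a i = 0" if "i < n" for i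
  proof (rule insert.IH[OF a(1)])
    fix w :: "'v \<Rightarrow> 'k"
    define q where "q = (\<Sum>i<n. Polynomial.monom (ev w (a i)) i)"
    have "poly q t = 0" for t
    proof -
      have "ev (w(v := t)) (a i) = ev w (a i)" for i
        using a(1)[of i] insert.hyps by (intro subst_cong[where V = V]) auto
      then have "poly q t = ev (w(v := t)) p"
        by (simp add: q_def a(2) poly_sum poly_monom id_hom.subst_sum id_hom.subst_simps)
      then show ?thesis by (simp add: insert.prems)
    qed
    then have "q = 0" by (rule poly_everywhere_0[OF inf])
    moreover have "Polynomial.coeff q i = ev w (a i)"
      using that by (simp add: q_def Polynomial.coeff_sum)
    ultimately show "ev w (a i) = 0" by simp
  qed
  then show ?case by (simp add: a(2))
qed

section \<open>Subrings as rings, and Hilbert's basis theorem\<close>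

text \<open>Passes from type class arithmetic to the record based rings in which the theorem is
  stated; \<open>coord_ring r\<close> is an instance.\<close>

definition ring_on :: "'a::comm_ring_1 set \<Rightarrow> 'a ring" where
  "ring_on A = \<lparr>carrier = A, monoid.mult = (*), one = 1, ring.zero = 0, add = (+)\<rparr>"

lemma ring_on_simps [simp]:
  "carrier (ring_on A) = A" "monoid.mult (ring_on A) = (*)" "one (ring_on A) = 1"
  "ring.zero (ring_on A) = 0" "add (ring_on A) = (+)"
  by (simp_all add: ring_on_def)

locale subring_set =
  fixes A :: "'a::comm_ring_1 set"
  assumes one_in: "1 \<in> A"
    and diff_in: "a \<in> A \<Longrightarrow> b \<in> A \<Longrightarrow> a - b \<in> A"
    and mult_in: "a \<in> A \<Longrightarrow> b \<in> A \<Longrightarrow> a * b \<in> A"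
begin

lemma zero_in: "0 \<in> A"
  using diff_in[OF one_in one_in] by simp

lemma uminus_in: "a \<in> A \<Longrightarrow> - a \<in> A"
  using diff_in[OF zero_in, of a] by simp

lemma add_in: "a \<in> A \<Longrightarrow> b \<in> A \<Longrightarrow> a + b \<in> A"
  using diff_in[of a "- b"] uminus_in[of b] by simp

lemma power_in: "a \<in> A \<Longrightarrow> a ^ n \<in> A"
  by (induction n) (auto intro: one_in mult_in)

lemmas closed = zero_in one_in add_in diff_in uminus_in mult_in power_in

lemma cring_ring_on: "cring (ring_on A)"
proof (rule cringI)
  show "abelian_group (ring_on A)"
    by (rule abelian_groupI)
       (auto simp: closed algebra_simps intro!: bexI[of _ "- x" for x] uminus_in)
  show "Group.comm_monoid (ring_on A)"
    by (rule comm_monoidI) (auto simp: closed algebra_simps)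
qed (auto simp: algebra_simps)

sublocale cring "ring_on A"
  by (rule cring_ring_on)

lemma a_inv_ring_on: "a \<in> A \<Longrightarrow> a_inv (ring_on A) a = - a"
  by (rule minus_equality) (auto simp: closed)

lemma nat_pow_ring_on: "a [^]\<^bsub>ring_on A\<^esub> (n::nat) = a ^ n"
  by (induction n) (auto simp: mult.commute)

lemma ideal_ring_on_iff:
  "ideal I (ring_on A) \<longleftrightarrow>
     I \<subseteq> A \<and> 0 \<in> I \<and> (\<forall>a\<in>I. \<forall>b\<in>I. a + b \<in> I) \<and> (\<forall>a\<in>I. \<forall>b\<in>A. b * a \<in> I)"
proof safe
  assume "ideal I (ring_on A)"
  then interpret I: ideal I "ring_on A" .
  show "x \<in> A" if "x \<in> I" for x using that I.Icarr by simp
  show "0 \<in> I" using I.zero_closed by simp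
  show "a + b \<in> I" if "a \<in> I" "b \<in> I" for a b using I.a_closed[OF that] by simp
  show "b * a \<in> I" if "a \<in> I" "b \<in> A" for a b using I.I_l_closed[of a b] that by simp
next
  assume I: "I \<subseteq> A" "0 \<in> I" "\<forall>a\<in>I. \<forall>b\<in>I. a + b \<in> I" "\<forall>a\<in>I. \<forall>b\<in>A. b * a \<in> I"
  have neg: "- a \<in> I" if "a \<in> I" for a
    using I(4)[rule_format, of a "-1"] that uminus_in[OF one_in] by simp
  have "subgroup I (add_monoid (ring_on A))"
  proof (rule group.subgroupI)
    show "Group.group (add_monoid (ring_on A))" by (rule a_group)
    fix a assume "a \<in> I"
    then show "m_inv (add_monoid (ring_on A)) a \<in> I"
      using neg a_inv_ring_on[of a] I(1) by (auto simp: a_inv_def)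
  qed (use I in auto)
  then show "ideal I (ring_on A)"
    using I(4) by (intro idealI ring_axioms) (auto simp: mult.commute)
qed

lemma ideal_diff:
  assumes "ideal I (ring_on A)" "a \<in> I" "b \<in> I"
  shows "a - b \<in> I"
proof -
  have I: "I \<subseteq> A" "\<And>a b. a \<in> I \<Longrightarrow> b \<in> I \<Longrightarrow> a + b \<in> I" "\<And>a b. a \<in> I \<Longrightarrow> b \<in> A \<Longrightarrow> b * a \<in> I"
    using assms(1) unfolding ideal_ring_on_iff by blast+
  have "-1 \<in> A" by (simp add: closed)
  then show ?thesis using I(2)[OF assms(2) I(3)[OF assms(3), of "-1"]] by simp
qed

text \<open>The leading coefficients, together with \<open>0\<close>, of the elements of \<open>J\<close> that are polynomial expressions of
  degree at most \<open>n\<close> in \<open>x\<close> over \<open>A\<close>. Since \<open>x\<close> need not be transcendental over \<open>A\<close>, one element can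
  contribute several of them.\<close>

definition lead :: "'a \<Rightarrow> 'a set \<Rightarrow> nat \<Rightarrow> 'a set" where
  "lead x J n = {a \<in> A. \<exists>c. (\<forall>i. c i \<in> A) \<and> a * x ^ n + (\<Sum>i<n. c i * x ^ i) \<in> J}"

end

text \<open>Ideals of \<open>B\<close> are compared through their leading coefficients. For an ideal
  \<open>J\<close> the sets \<open>lead x J n\<close> form an ascending chain of ideals of
  \<open>A\<close>, which becomes stationary; lifting finitely many generators of finitely many of
  them generates \<open>J\<close>.\<close>

lemma hilbert_basis_step:
  fixes x :: "'a::comm_ring_1"
  assumes A: "subring_set A" and B: "subring_set B" and "A \<subseteq> B" "x \<in> B"
    and repr: "\<And>p. p \<in> B \<Longrightarrow> \<exists>n c. (\<forall>i. c i \<in> A) \<and> p = (\<Sum>i<n::nat. c i * x ^ i)"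
    and noeth: "noetherian_ring (ring_on A)"
  shows "noetherian_ring (ring_on B)"
proof -
  interpret A: subring_set A by fact
  interpret B: subring_set B by fact
  interpret N: noetherian_ring "ring_on A" by fact
  have lead_ideal: "ideal (A.lead x J n) (ring_on A)" if J: "ideal J (ring_on B)" for J n
    unfolding A.ideal_ring_on_iff
  proof (intro conjI ballI)
    note J = J[unfolded B.ideal_ring_on_iff]
    show "A.lead x J n \<subseteq> A" by (auto simp: A.lead_def)
    show "0 \<in> A.lead x J n"
      using J A.closed by (auto simp: A.lead_def intro!: exI[of _ "\<lambda>_. 0"])
    fix a assume "a \<in> A.lead x J n"
    then obtain c where a: "a \<in> A" "\<forall>i. c i \<in> A" "a * x ^ n + (\<Sum>i<n. c i * x ^ i) \<in> J"
      by (auto simp: A.lead_def)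
    {
      fix b assume "b \<in> A.lead x J n"
      then obtain d where b: "b \<in> A" "\<forall>i. d i \<in> A" "b * x ^ n + (\<Sum>i<n. d i * x ^ i) \<in> J"
        by (auto simp: A.lead_def)
      have "(a * x ^ n + (\<Sum>i<n. c i * x ^ i)) + (b * x ^ n + (\<Sum>i<n. d i * x ^ i)) \<in> J"
        using J a(3) b(3) by blast
      then have "(a + b) * x ^ n + (\<Sum>i<n. (c i + d i) * x ^ i) \<in> J"
        by (simp add: algebra_simps sum.distrib)
      then show "a + b \<in> A.lead x J n"
        using a b by (auto simp: A.lead_def A.closed intro!: exI[of _ "\<lambda>i. c i + d i"])
    next
      fix b assume b: "b \<in> A"
      then have "b * (a * x ^ n + (\<Sum>i<n. c i * x ^ i)) \<in> J"
        using J a(3) \<open>A \<subseteq> B\<close> by auto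
      then have "(b * a) * x ^ n + (\<Sum>i<n. (b * c i) * x ^ i) \<in> J"
        by (simp add: algebra_simps sum_distrib_left)
      then show "b * a \<in> A.lead x J n"
        using a b by (auto simp: A.lead_def A.closed intro!: exI[of _ "\<lambda>i. b * c i"])
    }
  qed
  \<comment> \<open>Multiplication by \<open>x ^ k\<close> raises the degree and keeps the leading
    coefficient.\<close>
  have lead_add: "A.lead x J n \<subseteq> A.lead x J (n + k)" if J: "ideal J (ring_on B)" for J n k
  proof
    fix a assume "a \<in> A.lead x J n"
    then obtain c where a: "a \<in> A" "\<forall>i. c i \<in> A" "a * x ^ n + (\<Sum>i<n. c i * x ^ i) \<in> J"
      by (auto simp: A.lead_def)
    have "x ^ k * (a * x ^ n + (\<Sum>i<n. c i * x ^ i)) \<in> J"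
      using J a(3) B.power_in[OF \<open>x \<in> B\<close>, of k] unfolding B.ideal_ring_on_iff by blast
    also have "x ^ k * (a * x ^ n + (\<Sum>i<n. c i * x ^ i))
        = a * x ^ (n + k) + (\<Sum>i<n. c i * x ^ (i + k))"
      by (simp add: algebra_simps sum_distrib_left power_add)
    also have "(\<Sum>i<n. c i * x ^ (i + k)) = (\<Sum>i=k..<n+k. c (i - k) * x ^ i)"
      by (rule sum.reindex_bij_witness[of _ "\<lambda>i. i - k" "\<lambda>i. i + k"]) auto
    also have "\<dots> = (\<Sum>i<n+k. (if i < k then 0 else c (i - k)) * x ^ i)"
      by (intro sum.mono_neutral_cong_left) auto
    finally show "a \<in> A.lead x J (n + k)"
      using a A.zero_in
      by (auto simp: A.lead_def intro!: exI[of _ "\<lambda>i. if i < k then 0 else c (i - k)"])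
  qed
  \<comment> \<open>Descent on the degree: an element of \<open>J\<close> loses its top term when an
    element of \<open>K\<close> with the same leading coefficient is subtracted.\<close>
  have lead_le: "J \<subseteq> K"
    if J: "ideal J (ring_on B)" and K: "ideal K (ring_on B)" and "K \<subseteq> J"
      and le: "\<And>n. A.lead x J n \<subseteq> A.lead x K n" for J K
  proof -
    have "(\<Sum>i<n. c i * x ^ i) \<in> K"
      if "(\<Sum>i<n. c i * x ^ i) \<in> J" "\<And>i. c i \<in> A" for n c
      using that
    proof (induction n arbitrary: c)
      case 0
      then show ?case using K by (simp add: B.ideal_ring_on_iff)
    next
      case (Suc n)
      let ?p = "\<Sum>i<Suc n. c i * x ^ i"
      have "c n \<in> A.lead x J n"
        using Suc.prems by (auto simp: A.lead_def add.commute)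
      then have "c n \<in> A.lead x K n" using le by blast
      then obtain d where d: "\<forall>i. d i \<in> A" "c n * x ^ n + (\<Sum>i<n. d i * x ^ i) \<in> K" (is "?q \<in> K")
        by (auto simp: A.lead_def)
      have "?p - ?q \<in> J"
        using Suc.prems(1) d(2) \<open>K \<subseteq> J\<close> B.ideal_diff[OF J] by blast
      moreover have "?p - ?q = (\<Sum>i<n. (c i - d i) * x ^ i)"
        by (simp add: algebra_simps sum_subtractf)
      ultimately have "?p - ?q \<in> K"
        using Suc.IH[of "\<lambda>i. c i - d i"] Suc.prems(2) d(1) A.diff_in by auto
      then have "(?p - ?q) + ?q \<in> K"
        using d(2) K unfolding B.ideal_ring_on_iff by blast
      then show ?case by simp
    qed
    moreover have "J \<subseteq> B" using J by (simp add: B.ideal_ring_on_iff)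
    ultimately show ?thesis using repr by blast
  qed
  show ?thesis
  proof (rule B.noetherian_ringI)
    fix J assume J: "ideal J (ring_on B)"
    let ?L = "A.lead x J"
    have chain: "subset.chain {I. ideal I (ring_on A)} (range ?L)"
    proof (rule subset.chainI)
      show "range ?L \<subseteq> {I. ideal I (ring_on A)}" using lead_ideal[OF J] by blast
      fix S T assume "S \<in> range ?L" "T \<in> range ?L"
      then obtain m n where "S = ?L m" "T = ?L n" by blast
      then show "(\<subset>)\<^sup>=\<^sup>= S T \<or> (\<subset>)\<^sup>=\<^sup>= T S"
        using lead_add[OF J, of m "n - m"] lead_add[OF J, of n "m - n"]
        by (cases "m \<le> n") auto
    qed
    have "\<Union>(range ?L) \<in> range ?L"
      by (rule N.ideal_chain_is_trivial[OF _ chain]) auto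
    then obtain N where N: "\<Union>(range ?L) = ?L N" by blast
    \<comment> \<open>Lifts to \<open>J\<close> of generators of \<open>?L n\<close>. The quantifier
      over \<open>K\<close> allows the use of the ideal generated by the lifts for all degrees up to
      \<open>N\<close> at once.\<close>
    have "\<exists>G. finite G \<and> G \<subseteq> J \<and> (\<forall>K. ideal K (ring_on B) \<and> G \<subseteq> K \<longrightarrow> ?L n \<subseteq> A.lead x K n)" for n
    proof -
      obtain H where H: "H \<subseteq> A" "finite H" "?L n = genideal (ring_on A) H"
        using N.finetely_gen[OF lead_ideal[OF J, of n]] by auto
      have "\<forall>a\<in>H. \<exists>c. (\<forall>i. c i \<in> A) \<and> a * x ^ n + (\<Sum>i<n. c i * x ^ i) \<in> J"
        using A.genideal_self[of H] H by (auto simp: A.lead_def)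
      then obtain c where c: "\<forall>a\<in>H. (\<forall>i. c a i \<in> A) \<and> a * x ^ n + (\<Sum>i<n. c a i * x ^ i) \<in> J"
        by metis
      let ?G = "(\<lambda>a. a * x ^ n + (\<Sum>i<n. c a i * x ^ i)) ` H"
      have "?L n \<subseteq> A.lead x K n" if "ideal K (ring_on B)" "?G \<subseteq> K" for K
        unfolding H(3)
      proof (rule A.genideal_minimal[OF lead_ideal[OF that(1)]])
        show "H \<subseteq> A.lead x K n"
        proof
          fix a assume "a \<in> H"
          then show "a \<in> A.lead x K n"
            using c H(1) that(2) by (auto simp: A.lead_def intro!: exI[of _ "c a"])
        qed
      qed
      then show ?thesis using H(2) c by (intro exI[of _ ?G]) auto
    qed
    then obtain G where G: "\<And>n. finite (G n)" "\<And>n. G n \<subseteq> J"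
      "\<And>n K. ideal K (ring_on B) \<Longrightarrow> G n \<subseteq> K \<Longrightarrow> ?L n \<subseteq> A.lead x K n" by metis
    define F where "F = (\<Union>n\<le>N. G n)"
    have F: "F \<subseteq> J" "finite F" using G by (auto simp: F_def)
    have "J \<subseteq> B" using J by (simp add: B.ideal_ring_on_iff)
    have FB: "F \<subseteq> carrier (ring_on B)" using F(1) \<open>J \<subseteq> B\<close> by simp
    let ?K = "genideal (ring_on B) F"
    have K: "ideal ?K (ring_on B)" by (rule B.genideal_ideal[OF FB])
    have KJ: "?K \<subseteq> J" by (rule B.genideal_minimal[OF J F(1)])
    have small: "?L n \<subseteq> A.lead x ?K n" if "n \<le> N" for n
      using that B.genideal_self[OF FB] by (intro G(3)[OF K]) (auto simp: F_def)
    have "?L n \<subseteq> A.lead x ?K n" for n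
    \<comment> \<open>Beyond \<open>N\<close> nothing new appears in \<open>?L\<close>, and the
      leading coefficients in degree \<open>N\<close> move up by \<open>lead_add\<close>.\<close>
    proof (cases "n \<le> N")
      case False
      have "?L n \<subseteq> ?L N" using N by blast
      also have "\<dots> \<subseteq> A.lead x ?K N" by (rule small) simp
      also have "\<dots> \<subseteq> A.lead x ?K n" using lead_add[OF K, of N "n - N"] False by simp
      finally show ?thesis .
    qed (rule small)
    then have "J = ?K" using lead_le[OF J K KJ] KJ by blast
    then show "\<exists>F\<subseteq>carrier (ring_on B). finite F \<and> J = genideal (ring_on B) F"
      using F(2) FB by blast
  qed
qed

lemma subring_polys: "subring_set (polys V)"
  by unfold_locales (auto intro: polys_1 polys_diff polys_mult)

lemma noetherian_polys:
  assumes "finite V"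
  shows "noetherian_ring (ring_on (polys V :: (('v \<Rightarrow>\<^sub>0 nat) \<Rightarrow>\<^sub>0 'k::field) set))"
  using assms
proof (induction V rule: finite_induct)
  case empty
  interpret subring_set "polys {} :: (('v \<Rightarrow>\<^sub>0 nat) \<Rightarrow>\<^sub>0 'k::field) set" by (rule subring_polys)
  let ?R = "ring_on (polys {} :: (('v \<Rightarrow>\<^sub>0 nat) \<Rightarrow>\<^sub>0 'k::field) set)"
  show ?case
  proof (rule noetherian_ringI)
    fix I assume I: "ideal I ?R"
    have elem: "\<exists>k. p = const k" if "p \<in> polys {}" for p :: "('v \<Rightarrow>\<^sub>0 nat) \<Rightarrow>\<^sub>0 'k"
      using that by (induction p rule: polys_induct) (auto simp flip: const_add)
    show "\<exists>G\<subseteq>carrier ?R. finite G \<and> I = genideal ?R G"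
    \<comment> \<open>Without variables only constants are left, so a nonzero ideal contains a
      unit.\<close>
    proof (cases "I \<subseteq> {0}")
      case True
      then have "I = {0}" using I by (auto simp: ideal_ring_on_iff)
      then show ?thesis using genideal_zero polys_0 by (intro exI[of _ "{0}"]) auto
    next
      case False
      then obtain p where p: "p \<in> I" "p \<noteq> 0" by blast
      then have "p \<in> polys {}" using I by (auto simp: ideal_ring_on_iff)
      then obtain k where k: "p = const k" using elem by blast
      with p have "k \<noteq> 0" by (auto simp: const_0)
      then have "const (inverse k) * p = (1 :: ('v \<Rightarrow>\<^sub>0 nat) \<Rightarrow>\<^sub>0 'k)" by (simp add: k const_1 flip: const_mult)
      moreover have "const (inverse k) * p \<in> I"
        using I p(1) const_in_polys[of "inverse k" "{}"] unfolding ideal_ring_on_iff by blast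
      ultimately have "1 \<in> I" by simp
      then have "I = carrier ?R" using ideal.one_imp_carrier[OF I] by simp
      then show ?thesis using genideal_one polys_1 by (intro exI[of _ "{1}"]) auto
    qed
  qed
next
  case (insert v V)
  show ?case
    by (rule hilbert_basis_step[OF subring_polys subring_polys _ _ _ insert.IH, where x = "var v"])
       (use polys_mono[of V "insert v V"] in \<open>blast intro: var_in_polys elim: polys_insertE\<close>)+
qed

section \<open>Quotients, sums of ideals and vanishing ideals\<close>

context cring
begin

lemma non_zero_divisor_QuotI:
  assumes "ideal K R" "x \<in> carrier R"
    and cancel: "\<And>y. y \<in> carrier R \<Longrightarrow> x \<otimes> y \<in> K \<Longrightarrow> y \<in> K"
  shows "non_zero_divisor (R Quot K) (K +> x)"
  unfolding non_zero_divisor_def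
proof (intro ballI impI)
  interpret K: ideal K R by fact
  fix Y assume Y: "Y \<in> carrier (R Quot K)" "(K +> x) \<otimes>\<^bsub>R Quot K\<^esub> Y = \<zero>\<^bsub>R Quot K\<^esub>"
  then obtain y where y: "y \<in> carrier R" "Y = K +> y"
    by (auto simp: FactRing_def A_RCOSETS_def')
  have "K +> (x \<otimes> y) = K"
    using Y(2) K.rcoset_mult_add[OF assms(2) y(1)] by (simp add: FactRing_def y(2))
  then have "x \<otimes> y \<in> K"
    using K.a_rcos_self[of "x \<otimes> y"] assms(2) y(1) by auto
  then have "y \<in> K" by (rule cancel[OF y(1)])
  then show "Y = \<zero>\<^bsub>R Quot K\<^esub>"
    using K.a_rcos_const by (simp add: y(2) FactRing_def)
qed

lemma genideal_mono:
  assumes "S \<subseteq> T" "T \<subseteq> carrier R"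
  shows "Idl S \<subseteq> Idl T"
  using assms genideal_self[of T] by (intro genideal_minimal genideal_ideal) auto

lemma genideal_add:
  assumes "S \<subseteq> carrier R" "T \<subseteq> carrier R"
  shows "Idl S <+> Idl T = Idl (S \<union> T)"
proof -
  have ST: "S \<union> T \<subseteq> carrier R" using assms by blast
  have "Idl S \<subseteq> Idl (S \<union> T)" "Idl T \<subseteq> Idl (S \<union> T)"
    using ST by (simp_all add: genideal_mono)
  moreover have "Idl S \<subseteq> carrier R" "Idl T \<subseteq> carrier R"
    using assms by (auto dest: ideal.Icarr[OF genideal_ideal])
  moreover have "S \<subseteq> Idl S" "T \<subseteq> Idl T" using assms genideal_self by auto
  ultimately have "Idl (Idl S \<union> Idl T) = Idl (S \<union> T)"
    using ST genideal_self[of "Idl S \<union> Idl T"]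
    by (intro equalityI genideal_minimal genideal_ideal) auto
  then show ?thesis
    using union_genideal[OF genideal_ideal[OF assms(1)] genideal_ideal[OF assms(2)]] by simp
qed

lemma genideal_ideal_eq: "ideal I R \<Longrightarrow> Idl I = I"
  using genideal_self[of I] genideal_minimal[of I I] ideal.Icarr by fastforce

lemma ideal_sum_genideal:
  assumes "\<And>s. s \<in> S \<Longrightarrow> T s \<subseteq> carrier R"
  shows "ideal_sum R S (\<lambda>s. Idl (T s)) = Idl (\<Union>s\<in>S. T s)"
proof -
  have car: "(\<Union>s\<in>S. T s) \<subseteq> carrier R" using assms by blast
  have 1: "(\<Union>s\<in>S. Idl (T s)) \<subseteq> Idl (\<Union>s\<in>S. T s)"
    using genideal_mono[OF _ car] by blast
  have "T s \<subseteq> Idl (T s)" if "s \<in> S" for s by (rule genideal_self[OF assms[OF that]])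
  then have 2: "(\<Union>s\<in>S. T s) \<subseteq> (\<Union>s\<in>S. Idl (T s))" by blast
  have 3: "(\<Union>s\<in>S. Idl (T s)) \<subseteq> carrier R"
    using 1 ideal.Icarr[OF genideal_ideal[OF car]] by blast
  show ?thesis
    unfolding ideal_sum_def
    using genideal_minimal[OF genideal_ideal[OF car] 1] genideal_mono[OF 2 3] by blast
qed

end

context subring_set
begin

lemma radical_ring_on: "radical (ring_on A) I = {a \<in> A. \<exists>n>0. a ^ n \<in> I}"
  by (simp add: radical_def nat_pow_ring_on)

lemma radical_superset: "I \<subseteq> A \<Longrightarrow> I \<subseteq> radical (ring_on A) I"
  unfolding radical_ring_on by (auto intro!: exI[of _ "1::nat"])

text \<open>This is the colon ideal of \<open>I\<close> by \<open>S\<close>. Since it is an ideal,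
  an inclusion of \<open>x J\<close> in \<open>I\<close> can be checked on generators of
  \<open>J\<close>.\<close>

lemma ideal_colon:
  assumes "ideal I (ring_on A)" "S \<subseteq> A"
  shows "ideal {g \<in> A. \<forall>x\<in>S. x * g \<in> I} (ring_on A)"
proof -
  have I: "I \<subseteq> A" "0 \<in> I" "\<And>a b. a \<in> I \<Longrightarrow> b \<in> I \<Longrightarrow> a + b \<in> I"
      "\<And>a b. a \<in> I \<Longrightarrow> b \<in> A \<Longrightarrow> b * a \<in> I"
    using assms(1) unfolding ideal_ring_on_iff by blast+
  show ?thesis
    unfolding ideal_ring_on_iff using I(2,3) I(4)
    by (auto simp: closed distrib_left mult.left_commute[of _ b for b])
qed

end

section \<open>Vanishing ideals\<close>

definition van :: "'v set \<Rightarrow> ('v \<Rightarrow> 'k::comm_ring_1) set \<Rightarrow> (('v \<Rightarrow>\<^sub>0 nat) \<Rightarrow>\<^sub>0 'k) set" where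
  "van V W = {p \<in> polys V. \<forall>w\<in>W. ev w p = 0}"

lemma ideal_van: "ideal (van V W) (ring_on (polys V))"
  unfolding subring_set.ideal_ring_on_iff[OF subring_polys] van_def
  by (auto simp: id_hom.subst_simps polys_0 intro: polys_add polys_mult)

text \<open>Values lie in an integral domain, so a power vanishes at a point only where its base
  does. This gives alternative (a) for each member identified as a vanishing ideal.\<close>

lemma radical_ideal_van:
  fixes W :: "('v \<Rightarrow> 'k::idom) set"
  shows "radical_ideal (ring_on (polys V)) (van V W)"
proof -
  interpret subring_set "polys V :: (('v \<Rightarrow>\<^sub>0 nat) \<Rightarrow>\<^sub>0 'k) set" by (rule subring_polys)
  have "radical (ring_on (polys V)) (van V W) \<subseteq> van V W"
    unfolding radical_ring_on by (auto simp: van_def id_hom.subst_simps)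
  then show ?thesis
    unfolding radical_ideal_def using ideal_van radical_superset[of "van V W"]
    by (auto simp: van_def)
qed

text \<open>If \<open>x y\<close> vanishes on \<open>W\<close> and a polynomial curve in \<open>W\<close> through \<open>w\<close> is not contained in the zero set
  of \<open>x\<close>, then \<open>y\<close> vanishes on this curve, hence at \<open>w\<close>.\<close>

lemma van_cancel:
  fixes W :: "('v \<Rightarrow> 'k::idom) set"
  assumes inf: "infinite (UNIV :: 'k set)"
    and curve: "\<And>w. w \<in> W \<Longrightarrow> \<exists>\<gamma>. (\<forall>t. (\<lambda>v. poly (\<gamma> v) t) \<in> W) \<and> (\<forall>v. poly (\<gamma> v) 0 = w v)
                  \<and> subst (\<lambda>x. [:x:]) \<gamma> x \<noteq> 0"
    and y: "y \<in> polys V" "x * y \<in> van V W"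
  shows "y \<in> van V W"
proof -
  have "ev w y = 0" if "w \<in> W" for w
  proof -
    obtain \<gamma> where \<gamma>: "\<forall>t. (\<lambda>v. poly (\<gamma> v) t) \<in> W" "\<forall>v. poly (\<gamma> v) 0 = w v"
        "subst (\<lambda>x. [:x:]) \<gamma> x \<noteq> 0"
      using curve[OF \<open>w \<in> W\<close>] by blast
    have "subst (\<lambda>x. [:x:]) \<gamma> (x * y) = 0"
      using y(2) \<gamma>(1) by (intro poly_everywhere_0[OF inf]) (simp add: poly_subst van_def)
    then have "subst (\<lambda>x. [:x:]) \<gamma> y = 0"
      using \<gamma>(3) by (simp add: pCons_hom.subst_mult)
    then show ?thesis
      using poly_subst[of \<gamma> y 0] \<gamma>(2) by simp
  qed
  then show ?thesis using y(1) by (simp add: van_def)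
qed

section \<open>Substitution modulo an ideal\<close>

lemma subst_const_var: "subst const var p = p"
proof -
  have "p \<in> polys UNIV" by (simp add: polys_def)
  then show ?thesis by (induction p rule: polys_induct) (auto simp: const_hom.subst_simps)
qed

text \<open>Congruences modulo an ideal respect sums and products; for products,
  \<open>f * g - f' * g' = f * (g - g') + g' * (f - f')\<close>. With one substitution equal to
  \<open>var\<close> this reduces a polynomial to a normal form modulo \<open>K\<close>.\<close>

lemma subst_diff_in_ideal:
  assumes K: "ideal K (ring_on (polys V))" and "p \<in> polys V"
    and \<sigma>: "\<And>v. v \<in> V \<Longrightarrow> \<sigma> v \<in> polys V" and \<tau>: "\<And>v. v \<in> V \<Longrightarrow> \<tau> v \<in> polys V"
    and diff: "\<And>v. v \<in> V \<Longrightarrow> \<sigma> v - \<tau> v \<in> K"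
  shows "subst const \<sigma> p - subst const \<tau> p \<in> K"
  using assms(2)
proof (induction p rule: polys_induct)
  note K = K[unfolded subring_set.ideal_ring_on_iff[OF subring_polys]]
  case (const k)
  then show ?case using K by (simp add: const_hom.subst_simps)
next
  note K = K[unfolded subring_set.ideal_ring_on_iff[OF subring_polys]]
  case (add p q)
  then have "(subst const \<sigma> p - subst const \<tau> p) + (subst const \<sigma> q - subst const \<tau> q) \<in> K"
    using K by blast
  then show ?case by (simp add: const_hom.subst_simps algebra_simps)
next
  note K = K[unfolded subring_set.ideal_ring_on_iff[OF subring_polys]]
  case (var p v)
  have "subst const \<sigma> p \<in> polys V" by (rule subst_in_polys[OF var(1) \<sigma>])
  then have "subst const \<sigma> p * (\<sigma> v - \<tau> v) + \<tau> v * (subst const \<sigma> p - subst const \<tau> p) \<in> K"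
    using K var diff[of v] \<tau>[of v] by blast
  then show ?case by (simp add: const_hom.subst_simps algebra_simps)
qed

text \<open>Geometrically, the zero set of \<open>K\<close> is a union of two pieces that meet only in the origin, and \<open>\<sigma>\<close>, \<open>\<tau>\<close>
  are the restrictions to the pieces: a function is determined by its two restrictions.\<close>

lemma subst_sum_in_ideal:
  assumes K: "ideal K (ring_on (polys V))" and p: "p \<in> polys V"
    and \<sigma>: "\<And>v. v \<in> V \<Longrightarrow> \<sigma> v \<in> polys V" and \<tau>: "\<And>v. v \<in> V \<Longrightarrow> \<tau> v \<in> polys V"
    and sum: "\<And>v. v \<in> V \<Longrightarrow> var v - (\<sigma> v + \<tau> v) \<in> K"
    and prod: "\<And>u v. u \<in> V \<Longrightarrow> v \<in> V \<Longrightarrow> \<sigma> u * \<tau> v \<in> K"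
  shows "p - (subst const \<sigma> p + subst const \<tau> p - subst const (\<lambda>_. 0) p) \<in> K"
  using p
proof (induction p rule: polys_induct)
  note I = K[unfolded subring_set.ideal_ring_on_iff[OF subring_polys]]
  case (const k)
  then show ?case using I by (simp add: const_hom.subst_simps)
next
  note I = K[unfolded subring_set.ideal_ring_on_iff[OF subring_polys]]
  case (add p q)
  let ?d = "\<lambda>p. p - (subst const \<sigma> p + subst const \<tau> p - subst const (\<lambda>_. 0) p)"
  have "?d p + ?d q \<in> K" using I add by blast
  then show ?case by (simp add: const_hom.subst_simps algebra_simps)
next
  interpret subring_set "polys V :: (('a \<Rightarrow>\<^sub>0 nat) \<Rightarrow>\<^sub>0 'b) set" by (rule subring_polys)
  note I = K[unfolded ideal_ring_on_iff]
  have I_add: "a + b \<in> K" if "a \<in> K" "b \<in> K" for a b using I that by blast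
  have I_mult: "b * a \<in> K" if "a \<in> K" "b \<in> polys V" for a b using I that by blast
  case (var p v)
  let ?s = "subst const \<sigma> p" and ?t = "subst const \<tau> p" and ?z = "subst const (\<lambda>_. 0) p"
  \<comment> \<open>The colon ideal of \<open>K\<close> by \<open>S\<close> contains every
    \<open>\<rho> u\<close>; modulo it, substituting \<open>\<rho>\<close> into \<open>p\<close> is
    the same as substituting zero.\<close>
  have colon: "\<tau>' p \<in> {g \<in> polys V. \<forall>x\<in>S. x * g \<in> K}"
    if "\<tau>' = (\<lambda>p. subst const \<rho> p - ?z)" "\<And>v. v \<in> V \<Longrightarrow> \<rho> v \<in> polys V"
      "\<And>u x. u \<in> V \<Longrightarrow> x \<in> S \<Longrightarrow> x * \<rho> u \<in> K" "S \<subseteq> polys V" for \<tau>' \<rho> S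
    unfolding that(1) using that(2-)
    by (intro subst_diff_in_ideal[OF ideal_colon[OF K \<open>S \<subseteq> polys V\<close>] var(1)]) (auto simp: polys_0)
  have "?t - ?z \<in> {g \<in> polys V. \<forall>x\<in>\<sigma> ` V. x * g \<in> K}"
    by (rule colon) (auto intro: \<sigma> \<tau> prod)
  then have 1: "\<sigma> v * (?t - ?z) \<in> K" using var(2) by blast
  have "?s - ?z \<in> {g \<in> polys V. \<forall>x\<in>\<tau> ` V. x * g \<in> K}"
    by (rule colon) (auto intro: \<sigma> \<tau> simp: prod mult.commute)
  then have 2: "\<tau> v * (?s - ?z) \<in> K" using var(2) by blast
  have 3: "var v * (p - (?s + ?t - ?z)) \<in> K"
    using var by (intro I_mult var_in_polys)
  have "?s + ?t - ?z \<in> polys V"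
    by (intro polys_add polys_diff subst_in_polys[OF var(1)] \<sigma> \<tau> polys_0)
  then have 4: "(?s + ?t - ?z) * (var v - (\<sigma> v + \<tau> v)) \<in> K"
    using sum[OF var(2)] by (intro I_mult)
  \<comment> \<open>The mixed products cancel, leaving \<open>p * var v\<close> minus
    \<open>?s * \<sigma> v\<close> and \<open>?t * \<tau> v\<close>; substituting zero into
    \<open>p * var v\<close> gives 0.\<close>
  have "(var v * (p - (?s + ?t - ?z)) + (?s + ?t - ?z) * (var v - (\<sigma> v + \<tau> v)))
      + (\<sigma> v * (?t - ?z) + \<tau> v * (?s - ?z)) \<in> K"
    by (intro I_add 1 2 3 4)
  then show ?case by (simp add: const_hom.subst_simps algebra_simps)
qed

section \<open>Commuting nilpotent matrices\<close>

lemma mat2_eq_iff: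
  fixes M N :: "'k mat2"
  shows "M = N \<longleftrightarrow> M $ 1 $ 1 = N $ 1 $ 1 \<and> M $ 1 $ 2 = N $ 1 $ 2 \<and> M $ 2 $ 1 = N $ 2 $ 1 \<and> M $ 2 $ 2 = N $ 2 $ 2"
  by (auto simp: vec_eq_iff forall_2)

lemma mat2_mult_entry:
  fixes M N :: "'k::comm_ring_1 mat2"
  shows "(M ** N) $ i $ j = M $ i $ 1 * N $ 1 $ j + M $ i $ 2 * N $ 2 $ j"
  by (simp add: matrix_matrix_mult_def sum_2)

text \<open>By Cayley-Hamilton a traceless matrix squares to a scalar, minus its
  determinant.\<close>

lemma nilpotent_cone_iff:
  fixes M :: "'k::idom mat2"
  shows "M \<in> nilpotent_cone \<longleftrightarrow>
    M $ 2 $ 2 = - (M $ 1 $ 1) \<and> M $ 1 $ 1 * M $ 1 $ 1 + M $ 1 $ 2 * M $ 2 $ 1 = 0"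
proof -
  have sl2: "M \<in> sl2 \<longleftrightarrow> M $ 2 $ 2 = - (M $ 1 $ 1)"
    by (simp add: sl2_def trace_def sum_2 add_eq_0_iff)
  define d where "d = M $ 1 $ 1 * M $ 1 $ 1 + M $ 1 $ 2 * M $ 2 $ 1"
  have sq: "M ** (M ** N) = (\<chi> i j. d * N $ i $ j)" if "M $ 2 $ 2 = - (M $ 1 $ 1)" for N :: "'k mat2"
    unfolding mat2_eq_iff by (simp add: mat2_mult_entry that d_def algebra_simps)
  \<comment> \<open>Only even powers are scalar, so the nilpotency exponent \<open>n\<close> is
    doubled below; \<open>d ^ n = 0\<close> then forces \<open>d = 0\<close>.\<close>
  have pow: "(((**) M) ^^ (2 * n)) N = (\<chi> i j. d ^ n * N $ i $ j)"
    if "M $ 2 $ 2 = - (M $ 1 $ 1)" for n and N :: "'k mat2"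
    by (induction n) (auto simp: sq[OF that] mat2_eq_iff mult_ac)
  show ?thesis
  proof
    assume M: "M \<in> nilpotent_cone"
    then have tr: "M $ 2 $ 2 = - (M $ 1 $ 1)" using sl2 by (simp add: nilpotent_cone_def)
    from M obtain n where n: "(((**) M) ^^ n) (mat 1) = 0" by (auto simp: nilpotent_cone_def)
    have zero: "(((**) M) ^^ n) 0 = 0" for n
      by (induction n) (auto simp: mat2_eq_iff mat2_mult_entry)
    have "(((**) M) ^^ (2 * n)) (mat 1) = 0"
      unfolding mult_2 funpow_add by (simp add: n zero)
    then have "(\<chi> i j. d ^ n * (mat 1 :: 'k mat2) $ i $ j) $ 1 $ 1 = 0"
      by (simp only: pow[OF tr]) simp
    then have "d = 0" by (simp add: mat_def)
    with tr show "M $ 2 $ 2 = - (M $ 1 $ 1) \<and> M $ 1 $ 1 * M $ 1 $ 1 + M $ 1 $ 2 * M $ 2 $ 1 = 0"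
      by (simp add: d_def)
  next
    assume *: "M $ 2 $ 2 = - (M $ 1 $ 1) \<and> M $ 1 $ 1 * M $ 1 $ 1 + M $ 1 $ 2 * M $ 2 $ 1 = 0"
    then have "d = 0" by (simp add: d_def)
    then have "(((**) M) ^^ (2 * 1)) (mat 1) = 0"
      using pow[of 1 "mat 1"] * by (simp add: mat2_eq_iff del: mult_1_right)
    then show "M \<in> nilpotent_cone"
      using * sl2 by (auto simp: nilpotent_cone_def)
  qed
qed

text \<open>The nilpotent matrix \<open>s (a, -b)\<^sup>T (b, a)\<close>.\<close>

definition scaled_nilpotent :: "'k::comm_ring_1 \<Rightarrow> 'k \<Rightarrow> 'k \<Rightarrow> 'k mat2" where
  "scaled_nilpotent s a b = vector [vector [s * a * b, s * a * a], vector [- (s * b * b), - (s * a * b)]]"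

lemma scaled_nilpotent_entries [simp]:
  "scaled_nilpotent s a b $ 1 $ 1 = s * a * b" "scaled_nilpotent s a b $ 1 $ 2 = s * a * a"
  "scaled_nilpotent s a b $ 2 $ 1 = - (s * b * b)" "scaled_nilpotent s a b $ 2 $ 2 = - (s * a * b)"
  by (simp_all add: scaled_nilpotent_def)

lemma two_neq_0:
  assumes "CHAR('k::idom) \<noteq> 2"
  shows "(2 :: 'k) \<noteq> 0"
proof
  assume "(2 :: 'k) = 0"
  then have "CHAR('k) dvd 2"
    using of_nat_eq_0_iff_char_dvd[of 2, where 'a = 'k] by simp
  moreover from this have "CHAR('k) \<le> 2" "CHAR('k) \<noteq> 0"
    using dvd_imp_le[of "CHAR('k)" 2] dvd_pos_nat[of 2 "CHAR('k)"] by auto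
  ultimately show False
    using assms CHAR_not_1[where 'a = 'k] by linarith
qed

lemma commuting_nilpotents_iff:
  fixes v :: "nat \<Rightarrow> 'k::field mat2"
  assumes char: "CHAR('k) \<noteq> 2"
  shows "v \<in> commuting_nilpotents m \<longleftrightarrow>
    (\<exists>s a b. v = (\<lambda>i\<in>{1..m}. scaled_nilpotent (s i) a b))"
proof
  assume v: "v \<in> commuting_nilpotents m"
  define x y z where "x i = v i $ 1 $ 1" and "y i = v i $ 1 $ 2" and "z i = v i $ 2 $ 1" for i
  have nil: "v i $ 2 $ 2 = - x i" "x i * x i = - (y i * z i)" if "i \<in> {1..m}" for i
  proof -
    have "v i \<in> nilpotent_cone" using v that by (auto simp: commuting_nilpotents_def)
    then show "v i $ 2 $ 2 = - x i" "x i * x i = - (y i * z i)"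
      by (auto simp: nilpotent_cone_iff x_def y_def z_def add_eq_0_iff)
  qed
  have comm: "x i * y j = x j * y i" "y i * z j = y j * z i"
    if "i \<in> {1..m}" "j \<in> {1..m}" for i j
  proof -
    have "lie_bracket (v i) (v j) = 0" using v that by (auto simp: commuting_nilpotents_def)
    then have eq: "v i ** v j = v j ** v i" by (simp add: lie_bracket_def)
    from arg_cong[OF eq, of "\<lambda>M. M $ 1 $ 1"] show "y i * z j = y j * z i"
      by (simp add: mat2_mult_entry x_def y_def z_def mult.commute)
    \<comment> \<open>This entry of the commutator carries a factor 2; here the characteristic
      enters.\<close>
    from arg_cong[OF eq, of "\<lambda>M. M $ 1 $ 2"]
    have "2 * (x i * y j - x j * y i) = 0"
      using that by (simp add: mat2_mult_entry nil flip: x_def y_def z_def)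
    then show "x i * y j = x j * y i" using two_neq_0[OF char] by simp
  qed
  have v_eq: "v = (\<lambda>i\<in>{1..m}. scaled_nilpotent (s i) a b)"
    if "\<And>i. i \<in> {1..m} \<Longrightarrow> x i = s i * a * b" "\<And>i. i \<in> {1..m} \<Longrightarrow> y i = s i * a * a"
      "\<And>i. i \<in> {1..m} \<Longrightarrow> z i = - (s i * b * b)" for s a b
  proof
    fix i
    show "v i = (\<lambda>i\<in>{1..m}. scaled_nilpotent (s i) a b) i"
    proof (cases "i \<in> {1..m}")
      case True
      then show ?thesis using that[of i] nil(1)[of i] by (simp add: mat2_eq_iff x_def y_def z_def)
    next
      case False
      then show ?thesis using v by (auto simp: commuting_nilpotents_def PiE_def extensional_def)
    qed
  qed
  show "\<exists>s a b. v = (\<lambda>i\<in>{1..m}. scaled_nilpotent (s i) a b)"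
  proof (cases "\<exists>j\<in>{1..m}. y j \<noteq> 0")
    case False
    \<comment> \<open>If every \<open>y i\<close> is zero, then \<open>x i * x i = 0\<close>, and
      only the lower left entries survive.\<close>
    then have "v = (\<lambda>i\<in>{1..m}. scaled_nilpotent (- z i) 0 1)"
      using nil(2) by (intro v_eq) auto
    then show ?thesis by (intro exI)
  next
    case True
    then obtain j where j: "j \<in> {1..m}" "y j \<noteq> 0" by blast
    \<comment> \<open>The matrix with index \<open>j\<close> serves as pivot. The free factors
      \<open>s i\<close> let \<open>a\<close> and \<open>b\<close> be rational in its entries, so no
      square roots occur.\<close>
    have "v = (\<lambda>i\<in>{1..m}. scaled_nilpotent (y i) 1 (x j / y j))"
    proof (rule v_eq)
      fix i assume i: "i \<in> {1..m}"
      show "x i = y i * 1 * (x j / y j)"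
        unfolding mult_1_right times_divide_eq_right nonzero_eq_divide_eq[OF j(2)]
        using comm(1)[OF i j(1)] by (metis mult.commute)
      have "y j * y j * z i = y j * (y i * z j)" using comm(2)[OF i j(1)] by (simp add: mult_ac)
      also have "\<dots> = - (y i * (x j * x j))" using nil(2)[OF j(1)] by (simp add: mult_ac)
      finally have "z i * (y j * y j) = - (y i * (x j * x j))" by (metis mult.commute)
      then have "z i = - (y i * (x j * x j)) / (y j * y j)"
        using j(2) by (metis mult_eq_0_iff nonzero_eq_divide_eq)
      then show "z i = - (y i * (x j / y j) * (x j / y j))" by simp
    qed simp
    then show ?thesis by (intro exI)
  qed
next
  assume "\<exists>s a b. v = (\<lambda>i\<in>{1..m}. scaled_nilpotent (s i) a b)"
  then obtain s a b where v: "v = (\<lambda>i\<in>{1..m}. scaled_nilpotent (s i) a b)" by blast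
  have "lie_bracket (scaled_nilpotent t a b) (scaled_nilpotent u a b) = 0" for t u
    by (simp add: lie_bracket_def mat2_eq_iff mat2_mult_entry algebra_simps)
  moreover have "scaled_nilpotent t a b \<in> nilpotent_cone" for t
    by (simp add: nilpotent_cone_iff algebra_simps)
  ultimately show "v \<in> commuting_nilpotents m"
    by (auto simp: commuting_nilpotents_def v)
qed

section \<open>Parametrised points\<close>

fun pt :: "(nat \<Rightarrow> 'k) \<Rightarrow> 'k \<Rightarrow> 'k \<Rightarrow> coord \<Rightarrow> 'k::comm_ring_1" where
  "pt s a b (CX i) = s i * a * b"
| "pt s a b (CY i) = s i * a * a"
| "pt s a b (CZ i) = - (s i * b * b)"

text \<open>Points of the cone with the first \<open>n\<close> components zero. Index 0 carries no
  coordinate of the ring, so \<open>n = 0\<close> stands for the whole of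
  \<open>C_r(N)\<close>.\<close>

definition cone_pts :: "nat \<Rightarrow> (coord \<Rightarrow> 'k::comm_ring_1) set" where
  "cone_pts n = {pt s a b | s a b. \<forall>i\<le>n. s i = 0}"

text \<open>With the direction fixed the points form a linear space. For \<open>b = 1\<close> it is
  \<open>x = y = - z\<close>, for \<open>b = -1\<close> it is \<open>x = - y = z\<close>; on the
  cone these are the two solutions of \<open>y + z = 0\<close>.\<close>

definition line_pts :: "nat \<Rightarrow> 'k \<Rightarrow> (coord \<Rightarrow> 'k::comm_ring_1) set" where
  "line_pts n b = {pt s 1 b | s. \<forall>i\<le>n. s i = 0}"

lemma coord_ring_eq: "coord_ring r = ring_on (polys (coords r))"
  by (simp add: coord_ring_def ring_on_def polys_def)

lemma coord_var_eq: "coord_var = var"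
  by (simp add: fun_eq_iff coord_var_def var_def)

lemma coord_eval_eq: "coord_eval p v = ev (coord_value v) p"
  by (simp add: coord_eval_def subst_def mono_value_def)

text \<open>Matrix tuples and parametrised points take the same values on \<open>coords r\<close>,
  and by \<open>subst_cong\<close> a polynomial of the ring depends on nothing else.\<close>

lemma I_ideal_eq:
  assumes char: "CHAR('k::field) \<noteq> 2" and "m \<le> r"
  shows "I_ideal r m = (van (coords r) (cone_pts (r - m)) :: 'k coord_poly set)"
proof -
  let ?C = "padded_commuting_nilpotents r m :: (nat \<Rightarrow> 'k mat2) set"
  have 1: "\<exists>w\<in>cone_pts (r - m). \<forall>c\<in>coords r. coord_value v c = w c" if "v \<in> ?C" for v
  proof -
    obtain u where u: "u \<in> commuting_nilpotents m"
      and v: "v = (\<lambda>i\<in>{1..r}. if i \<le> r - m then 0 else u (i - (r - m)))"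
      using \<open>v \<in> ?C\<close> unfolding padded_commuting_nilpotents_def by (rule imageE)
    obtain s a b where u_eq: "u = (\<lambda>i\<in>{1..m}. scaled_nilpotent (s i) a b)"
      using u unfolding commuting_nilpotents_iff[OF char] by (elim exE)
    define w where "w = pt (\<lambda>i. if i \<le> r - m then 0 else s (i - (r - m))) a b"
    have "w \<in> cone_pts (r - m)"
      unfolding w_def cone_pts_def mem_Collect_eq by (intro exI conjI refl) auto
    moreover have "coord_value v c = w c" if "c \<in> coords r" for c
      using that \<open>m \<le> r\<close> by (auto simp: coords_def v u_eq w_def)
    ultimately show ?thesis by blast
  qed
  have 2: "\<exists>v\<in>?C. \<forall>c\<in>coords r. coord_value v c = w c" if "w \<in> cone_pts (r - m)" for w
  proof -
    obtain s a b where w: "w = pt s a b" "\<forall>i\<le>r - m. s i = 0"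
      using \<open>w \<in> cone_pts (r - m)\<close> by (auto simp: cone_pts_def)
    \<comment> \<open>The parameters are shifted down by \<open>r - m\<close>, undoing the padding
      with leading zeros.\<close>
    define v where "v = (\<lambda>i\<in>{1..r}. if i \<le> r - m then 0
        else (\<lambda>i\<in>{1..m}. scaled_nilpotent (s (i + (r - m))) a b) (i - (r - m)))"
    have "v \<in> ?C"
      unfolding padded_commuting_nilpotents_def v_def commuting_nilpotents_iff[OF char] mem_Collect_eq
      by (rule image_eqI[OF refl]) (unfold commuting_nilpotents_iff[OF char], intro exI, rule refl)
    moreover have "coord_value v c = w c" if "c \<in> coords r" for c
      using that w \<open>m \<le> r\<close> by (auto simp: coords_def v_def)
    ultimately show ?thesis by blast
  qed
  have "(\<forall>v\<in>?C. coord_eval p v = 0) \<longleftrightarrow> (\<forall>w\<in>cone_pts (r - m). ev w p = 0)"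
    if "p \<in> polys (coords r)" for p
    using 1 2 subst_cong[OF that, where h = "\<lambda>x. x"] unfolding coord_eval_eq by metis
  then show ?thesis
    by (auto simp: I_ideal_def vanishing_ideal_def van_def coord_ring_eq)
qed

section \<open>The family of ideals\<close>

lemma finite_coords: "finite (coords r)"
  by (simp add: coords_def)

lemma coord_in_coords [simp]:
  "CX i \<in> coords r \<longleftrightarrow> i \<in> {1..r}" "CY i \<in> coords r \<longleftrightarrow> i \<in> {1..r}" "CZ i \<in> coords r \<longleftrightarrow> i \<in> {1..r}"
  by (auto simp: coords_def)

text \<open>The first three are minors expressing proportionality; the last polarises the nilpotency
  equation \<open>x * x + y * z = 0\<close>. All are identities in the parameters.\<close>

lemma quadrics_vanish:
  assumes "i \<in> {1..r}" "j \<in> {1..r}"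
  shows "var (CX i) * var (CY j) - var (CX j) * var (CY i) \<in> van (coords r) (cone_pts n)"
    and "var (CX i) * var (CZ j) - var (CX j) * var (CZ i) \<in> van (coords r) (cone_pts n)"
    and "var (CY i) * var (CZ j) - var (CY j) * var (CZ i) \<in> van (coords r) (cone_pts n)"
    and "var (CX i) * var (CX j) + var (CY i) * var (CZ j) \<in> van (coords r) (cone_pts n)"
  using assms
  by (auto simp: van_def cone_pts_def id_hom.subst_simps algebra_simps
      intro!: polys_diff polys_add polys_mult var_in_polys)

text \<open>\<open>slice r m 0\<close> and \<open>slice r r n\<close> are the third and the fourth kind of member of the family.\<close>

definition slice_gens :: "nat \<Rightarrow> nat \<Rightarrow> nat \<Rightarrow> 'k::comm_ring_1 coord_poly set" where
  "slice_gens r m n = van (coords r) (cone_pts 0)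
     \<union> (\<Union>i\<in>{1..m}. {var (CY i) + var (CZ i)}) \<union> (\<Union>j\<in>{1..n}. {var (CX j) + var (CY j)})"

definition slice :: "nat \<Rightarrow> nat \<Rightarrow> nat \<Rightarrow> 'k::comm_ring_1 coord_poly set" where
  "slice r m n = genideal (ring_on (polys (coords r))) (slice_gens r m n)"

definition P_gens :: "nat \<Rightarrow> nat \<Rightarrow> 'k::comm_ring_1 coord_poly set" where
  "P_gens r m = (\<Union>i\<in>{1..m}. {var (CX i), var (CY i), var (CZ i)})
     \<union> (\<Union>j\<in>{m+1..r}. {var (CX j) - var (CY j), var (CY j) + var (CZ j)})"

lemma line_ptsI: "\<forall>i\<le>n. s i = 0 \<Longrightarrow> pt s 1 b \<in> line_pts n b"
  by (auto simp: line_pts_def)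

lemma cone_ptsI: "\<forall>i\<le>n. s i = 0 \<Longrightarrow> pt s a b \<in> cone_pts n"
  by (auto simp: cone_pts_def)

section \<open>The slices, and adjoining one more linear form\<close>

locale coord_polys =
  fixes r :: nat and k_type :: "'k::alg_closed_field itself"
begin

abbreviation "S \<equiv> polys (coords r) :: 'k coord_poly set"

abbreviation "Q m n \<equiv> slice r m n :: 'k coord_poly set"

sublocale subring_set S
  by (rule subring_polys)

lemma inf: "infinite (UNIV :: 'k set)"
  by (rule infinite_UNIV_alg_closed)

lemma slice_gens_subset: "m \<le> r \<Longrightarrow> n \<le> r \<Longrightarrow> slice_gens r m n \<subseteq> S"
  by (auto simp: slice_gens_def van_def intro!: polys_add var_in_polys)

lemma P_gens_subset: "m \<le> r \<Longrightarrow> P_gens r m \<subseteq> S"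
  by (auto simp: P_gens_def intro!: polys_add polys_diff var_in_polys)

lemma ideal_slice: "m \<le> r \<Longrightarrow> n \<le> r \<Longrightarrow> ideal (Q m n) (ring_on S)"
  unfolding slice_def using slice_gens_subset by (intro genideal_ideal) simp

lemma
  assumes "m \<le> r" "n \<le> r"
  shows slice_van: "p \<in> van (coords r) (cone_pts 0) \<Longrightarrow> p \<in> Q m n"
    and slice_yz: "i \<in> {1..m} \<Longrightarrow> var (CY i) + var (CZ i) \<in> Q m n"
    and slice_xy: "i \<in> {1..n} \<Longrightarrow> var (CX i) + var (CY i) \<in> Q m n"
proof -
  have "slice_gens r m n \<subseteq> Q m n"
    unfolding slice_def using slice_gens_subset[OF assms] by (intro genideal_self) simp
  then show "p \<in> van (coords r) (cone_pts 0) \<Longrightarrow> p \<in> Q m n"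
    "i \<in> {1..m} \<Longrightarrow> var (CY i) + var (CZ i) \<in> Q m n"
    "i \<in> {1..n} \<Longrightarrow> var (CX i) + var (CY i) \<in> Q m n"
    unfolding slice_gens_def by blast+
qed

lemma slice_add: "m \<le> r \<Longrightarrow> n \<le> r \<Longrightarrow> p \<in> Q m n \<Longrightarrow> q \<in> Q m n \<Longrightarrow> p + q \<in> Q m n"
  using ideal_slice[of m n] unfolding ideal_ring_on_iff by blast

lemma slice_mult: "m \<le> r \<Longrightarrow> n \<le> r \<Longrightarrow> p \<in> S \<Longrightarrow> q \<in> Q m n \<Longrightarrow> p * q \<in> Q m n"
  using ideal_slice[of m n] unfolding ideal_ring_on_iff by blast

lemma slice_diff: "m \<le> r \<Longrightarrow> n \<le> r \<Longrightarrow> p \<in> Q m n \<Longrightarrow> q \<in> Q m n \<Longrightarrow> p - q \<in> Q m n"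
  by (rule ideal_diff[OF ideal_slice])

lemma slice_subset_van:
  assumes "m \<le> r" "n \<le> r" "W \<subseteq> cone_pts 0"
    and "\<And>w i. w \<in> W \<Longrightarrow> i \<in> {1..m} \<Longrightarrow> w (CY i) + w (CZ i) = 0"
    and "\<And>w i. w \<in> W \<Longrightarrow> i \<in> {1..n} \<Longrightarrow> w (CX i) + w (CY i) = 0"
  shows "Q m n \<subseteq> (van (coords r) W :: 'k coord_poly set)"
  unfolding slice_def
proof (rule genideal_minimal[OF ideal_van])
  have "slice_gens r m n \<subseteq> S" by (rule slice_gens_subset[OF assms(1,2)])
  moreover have "ev w p = 0" if "p \<in> slice_gens r m n" "w \<in> W" for p w
    using that assms(3-) by (auto simp: slice_gens_def van_def id_hom.subst_simps)
  ultimately show "slice_gens r m n \<subseteq> van (coords r) W"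
    by (auto simp: van_def)
qed

lemma genideal_add_PIdl:
  assumes "G \<subseteq> S" "x \<in> S"
  shows "genideal (ring_on S) G <+>\<^bsub>ring_on S\<^esub> PIdl\<^bsub>ring_on S\<^esub> x = genideal (ring_on S) (insert x G)"
  using genideal_add[of G "{x}"] assms by (simp add: cgenideal_eq_genideal)

lemma slice_Suc_yz:
  assumes "Suc m \<le> r" "n \<le> r"
  shows "Q m n <+>\<^bsub>ring_on S\<^esub> PIdl\<^bsub>ring_on S\<^esub> (var (CY (Suc m)) + var (CZ (Suc m))) = Q (Suc m) n"
proof -
  have gens: "(slice_gens r (Suc m) n :: 'k coord_poly set) = insert (var (CY (Suc m)) + var (CZ (Suc m))) (slice_gens r m n)"
    by (auto simp: slice_gens_def atLeastAtMostSuc_conv)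
  show ?thesis
    unfolding slice_def gens using slice_gens_subset[of m n] assms
    by (intro genideal_add_PIdl) (auto intro!: polys_add var_in_polys)
qed

lemma slice_Suc_xy:
  assumes "m \<le> r" "Suc n \<le> r"
  shows "Q m n <+>\<^bsub>ring_on S\<^esub> PIdl\<^bsub>ring_on S\<^esub> (var (CX (Suc n)) + var (CY (Suc n))) = Q m (Suc n)"
proof -
  have gens: "(slice_gens r m (Suc n) :: 'k coord_poly set) = insert (var (CX (Suc n)) + var (CY (Suc n))) (slice_gens r m n)"
    by (auto simp: slice_gens_def atLeastAtMostSuc_conv)
  show ?thesis
    unfolding slice_def gens using slice_gens_subset[of m n] assms
    by (intro genideal_add_PIdl) (auto intro!: polys_add var_in_polys)
qed

section \<open>Members of the family as vanishing ideals\<close>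

lemma line_pts_subset_cone_pts: "line_pts n b \<subseteq> (cone_pts 0 :: (coord \<Rightarrow> 'k) set)"
  by (auto simp: line_pts_def cone_pts_def)

text \<open>Here \<open>\<phi>\<close> is a normal form modulo \<open>K\<close> that sends every
  point into \<open>W\<close>. Substituting it into \<open>p\<close> gives a function vanishing
  everywhere, hence the zero polynomial, while \<open>p\<close> is congruent to that result modulo
  \<open>K\<close>.\<close>

lemma mem_ideal_if_subst_0:
  fixes \<phi> :: "coord \<Rightarrow> 'k coord_poly"
  assumes K: "ideal K (ring_on S)" and p: "p \<in> van (coords r) W"
    and \<phi>: "\<And>v. v \<in> coords r \<Longrightarrow> \<phi> v \<in> S" "\<And>v. v \<in> coords r \<Longrightarrow> var v - \<phi> v \<in> K"
    and W: "\<And>w. (\<lambda>v. ev w (\<phi> v)) \<in> W"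
  shows "p \<in> K"
proof -
  have pS: "p \<in> S" using p by (simp add: van_def)
  have "subst const \<phi> p = 0"
  proof (rule ev_everywhere_0[OF inf finite_coords])
    show "subst const \<phi> p \<in> S" by (rule subst_in_polys[OF pS \<phi>(1)])
    show "ev w (subst const \<phi> p) = 0" for w
      using p W[of w] by (simp add: ev_subst van_def)
  qed
  moreover have "subst const var p - subst const \<phi> p \<in> K"
    by (rule subst_diff_in_ideal[OF K pS]) (auto intro: \<phi> var_in_polys)
  ultimately show ?thesis by (simp add: subst_const_var)
qed

lemma P_gens_van:
  assumes "m \<le> r"
  shows "genideal (ring_on S) (P_gens r m) = van (coords r) (line_pts m 1)"
proof
  let ?K = "genideal (ring_on S) (P_gens r m)"
  show "?K \<subseteq> van (coords r) (line_pts m (1 :: 'k))"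
  proof (rule genideal_minimal[OF ideal_van])
    have "ev w p = 0" if "p \<in> P_gens r m" "w \<in> line_pts m 1" for p and w :: "coord \<Rightarrow> 'k"
      using that by (auto simp: P_gens_def line_pts_def id_hom.subst_simps)
    then show "P_gens r m \<subseteq> van (coords r) (line_pts m (1 :: 'k))"
      using P_gens_subset[OF assms] unfolding van_def by blast
  qed
  have K: "ideal ?K (ring_on S)"
    using P_gens_subset[OF assms] by (intro genideal_ideal) simp
  have gens: "P_gens r m \<subseteq> ?K"
    using P_gens_subset[OF assms] by (intro genideal_self) simp
  \<comment> \<open>\<open>pt\<close> taken over the polynomial ring: modulo the generators only the
    \<open>y\<close> variables with index above \<open>m\<close> remain free.\<close>
  define \<phi> where "\<phi> = pt (\<lambda>i. if i \<le> m then 0 else var (CY i) :: 'k coord_poly) 1 1"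
  show "van (coords r) (line_pts m (1 :: 'k)) \<subseteq> ?K"
  proof
    fix p assume p: "p \<in> van (coords r) (line_pts m (1::'k))"
    show "p \<in> ?K"
    proof (rule mem_ideal_if_subst_0[OF K p, where \<phi> = \<phi>])
      fix v assume v: "v \<in> coords r"
      then show "\<phi> v \<in> S"
        by (cases v) (auto simp: \<phi>_def polys_0 intro!: polys_uminus var_in_polys)
      have "0 \<in> ?K" using K by (simp add: ideal_ring_on_iff)
      moreover have "var v - \<phi> v \<in> P_gens r m \<or> var v - \<phi> v = 0"
        using v by (cases v) (auto simp: \<phi>_def P_gens_def add.commute)
      ultimately show "var v - \<phi> v \<in> ?K" using gens by auto
    next
      fix w
      have "(\<lambda>v. ev w (\<phi> v)) = pt (\<lambda>i. if i \<le> m then 0 else w (CY i)) 1 1"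
      proof
        show "ev w (\<phi> v) = pt (\<lambda>i. if i \<le> m then 0 else w (CY i)) 1 1 v" for v
          by (cases v) (auto simp: \<phi>_def id_hom.subst_simps)
      qed
      then show "(\<lambda>v. ev w (\<phi> v)) \<in> line_pts m 1"
        by (simp add: line_ptsI)
    qed
  qed
qed

lemma slice_full_van: "Q r r = van (coords r) (line_pts 0 (-1))"
proof
  show "Q r r \<subseteq> van (coords r) (line_pts 0 (- 1))"
    by (rule slice_subset_van[OF _ _ line_pts_subset_cone_pts]) (auto simp: line_pts_def)
  define \<phi> where "\<phi> = pt (\<lambda>i. var (CY i) :: 'k coord_poly) 1 (-1)"
  show "van (coords r) (line_pts 0 (-1)) \<subseteq> Q r r"
  proof
    fix p assume p: "p \<in> van (coords r) (line_pts 0 (-1::'k))"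
    show "p \<in> Q r r"
    \<comment> \<open>Outside \<open>coords r\<close> the substitution is zero, so the parameter at
      index 0 vanishes, as \<open>line_pts 0\<close> demands.\<close>
    proof (rule mem_ideal_if_subst_0[OF ideal_slice p, where \<phi> = "\<lambda>v. if v \<in> coords r then \<phi> v else 0"])
      fix v assume v: "v \<in> coords r"
      then show "(if v \<in> coords r then \<phi> v else 0) \<in> S"
        by (cases v) (auto simp: \<phi>_def intro!: polys_uminus var_in_polys)
      have "0 \<in> Q r r"
        using ideal_slice[of r r] by (simp add: ideal_ring_on_iff)
      then show "var v - (if v \<in> coords r then \<phi> v else 0) \<in> Q r r"
        using v slice_yz[of r r] slice_xy[of r r]
        by (cases v) (auto simp: \<phi>_def add.commute)
    next
      fix w
      have "(\<lambda>v. ev w (if v \<in> coords r then \<phi> v else 0))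
          = pt (\<lambda>i. if i \<in> {1..r} then w (CY i) else 0) 1 (-1)"
      proof
        show "ev w (if v \<in> coords r then \<phi> v else 0)
            = pt (\<lambda>i. if i \<in> {1..r} then w (CY i) else 0) 1 (-1) v" for v
          by (cases v) (auto simp: \<phi>_def id_hom.subst_simps)
      qed
      then show "(\<lambda>v. ev w (if v \<in> coords r then \<phi> v else 0)) \<in> line_pts 0 (-1)"
        by (simp add: line_ptsI)
    qed auto
  qed
qed

text \<open>A polynomial vanishing on both linear spaces becomes zero under both restrictions and at
  the origin; \<open>subst_sum_in_ideal\<close> recovers it from these three modulo the
  slice.\<close>

lemma slice_yz_van:
  assumes two: "(2 :: 'k) \<noteq> 0"
  shows "Q r 0 = van (coords r) (line_pts 0 1 \<union> line_pts 0 (-1))"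
proof
  show "Q r 0 \<subseteq> van (coords r) (line_pts 0 1 \<union> line_pts 0 (- 1))"
    by (intro slice_subset_van Un_least line_pts_subset_cone_pts) (auto simp: line_pts_def)
  define H :: "'k coord_poly" where "H = const (1 / 2)"
  have H: "H + H = 1"
    using two by (simp add: H_def const_1 flip: const_add)
  \<comment> \<open>\<open>\<phi>\<close> and \<open>\<psi>\<close> project onto the spaces
    \<open>x = y = - z\<close> and \<open>x = - y = z\<close>. Their sum is the identity modulo
    \<open>y + z\<close>, which requires the half \<open>H\<close>.\<close>
  define \<phi> where "\<phi> = pt (\<lambda>i. if i = 0 then 0 else H * (var (CX i) + var (CY i))) 1 1"
  define \<psi> where "\<psi> = pt (\<lambda>i. if i = 0 then 0 else H * (var (CY i) - var (CX i))) 1 (-1)"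
  have sub: "\<phi> v \<in> S" "\<psi> v \<in> S" if "v \<in> coords r" for v
    using that by (cases v; auto simp: \<phi>_def \<psi>_def H_def polys_0
        intro!: polys_uminus polys_mult polys_add polys_diff const_in_polys var_in_polys)+
  have half: "x - (H * (x + y) - H * (y - x)) = 0" "y - (H * (x + y) + H * (y - x)) = 0"
      "z - (- (H * (x + y)) - H * (y - x)) = y + z" for x y z
  proof -
    have "H * x + H * x = x" "H * y + H * y = y"
      using H by (metis distrib_right mult_1)+
    then show "x - (H * (x + y) - H * (y - x)) = 0" "y - (H * (x + y) + H * (y - x)) = 0"
        "z - (- (H * (x + y)) - H * (y - x)) = y + z"
      by (simp_all add: algebra_simps add_eq_0_iff)
  qed
  \<comment> \<open>The quadric \<open>x\<^sub>i x\<^sub>j + y\<^sub>i z\<^sub>j\<close> factors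
    once \<open>z\<^sub>j\<close> is replaced by \<open>- y\<^sub>j\<close> and the minor in
    \<open>x\<close>, \<open>y\<close> is subtracted.\<close>
  have prod: "(var (CX i) + var (CY i)) * (var (CX j) - var (CY j)) \<in> Q r 0"
    if ij: "i \<in> {1..r}" "j \<in> {1..r}" for i j
  proof -
    have "((var (CX i) * var (CX j) + var (CY i) * var (CZ j))
        - (var (CX i) * var (CY j) - var (CX j) * var (CY i)))
        - var (CY i) * (var (CY j) + var (CZ j)) \<in> Q r 0"
      using ij by (intro slice_diff slice_mult slice_van quadrics_vanish slice_yz var_in_polys) auto
    then show ?thesis by (simp add: algebra_simps)
  qed
  have prod': "s * t \<in> Q r 0"
    if "s = c * (var (CX i) + var (CY i))" "t = d * (var (CX j) - var (CY j))"
      "c \<in> S" "d \<in> S" "i \<in> {1..r}" "j \<in> {1..r}" for s t c d i j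
  proof -
    have "s * t = (c * d) * ((var (CX i) + var (CY i)) * (var (CX j) - var (CY j)))"
      using that(1,2) by (simp add: mult_ac)
    then show ?thesis
      using that(3-) by (auto intro!: slice_mult prod polys_mult)
  qed
  show "van (coords r) (line_pts 0 1 \<union> line_pts 0 (- 1)) \<subseteq> Q r 0"
  proof
    fix p assume p: "p \<in> van (coords r) (line_pts 0 1 \<union> line_pts 0 (- 1 :: 'k))"
    then have pS: "p \<in> S" by (simp add: van_def)
    have zero: "subst const \<upsilon> p = 0"
      if "\<And>v. v \<in> coords r \<Longrightarrow> \<upsilon> v \<in> S" "\<And>w. (\<lambda>v. ev w (\<upsilon> v)) \<in> line_pts 0 1 \<union> line_pts 0 (-1)" for \<upsilon>
    proof (rule ev_everywhere_0[OF inf finite_coords])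
      show "subst const \<upsilon> p \<in> S" by (rule subst_in_polys[OF pS that(1)])
      show "ev w (subst const \<upsilon> p) = 0" for w
        using p that(2)[of w] by (auto simp: ev_subst van_def)
    qed
    have "subst const \<phi> p = 0"
    proof (rule zero[OF sub(1)])
      fix w
      have "(\<lambda>v. ev w (\<phi> v)) = pt (\<lambda>i. if i = 0 then 0 else (w (CX i) + w (CY i)) / 2) 1 1"
      proof
        show "ev w (\<phi> v) = pt (\<lambda>i. if i = 0 then 0 else (w (CX i) + w (CY i)) / 2) 1 1 v" for v
          by (cases v) (auto simp: \<phi>_def H_def id_hom.subst_simps)
      qed
      then show "(\<lambda>v. ev w (\<phi> v)) \<in> line_pts 0 1 \<union> line_pts 0 (-1)"
        by (simp add: line_ptsI)
    qed
    moreover have "subst const \<psi> p = 0"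
    proof (rule zero[OF sub(2)])
      fix w
      have "(\<lambda>v. ev w (\<psi> v)) = pt (\<lambda>i. if i = 0 then 0 else (w (CY i) - w (CX i)) / 2) 1 (-1)"
      proof
        show "ev w (\<psi> v) = pt (\<lambda>i. if i = 0 then 0 else (w (CY i) - w (CX i)) / 2) 1 (-1) v" for v
          by (cases v) (auto simp: \<psi>_def H_def id_hom.subst_simps)
      qed
      then show "(\<lambda>v. ev w (\<psi> v)) \<in> line_pts 0 1 \<union> line_pts 0 (-1)"
        by (simp add: line_ptsI)
    qed
    moreover have "subst const (\<lambda>_. 0 :: 'k coord_poly) p = 0"
    proof (rule zero)
      fix w :: "coord \<Rightarrow> 'k"
      have "(\<lambda>v. ev w 0) = pt (\<lambda>_. 0) 1 1"
      proof
        show "ev w 0 = pt (\<lambda>_. 0) 1 1 v" for v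
          by (cases v) (auto simp: id_hom.subst_simps)
      qed
      then show "(\<lambda>v. ev w 0) \<in> line_pts 0 1 \<union> line_pts 0 (-1)"
        by (simp add: line_ptsI)
    qed (simp add: polys_0)
    moreover have "p - (subst const \<phi> p + subst const \<psi> p - subst const (\<lambda>_. 0) p) \<in> Q r 0"
    proof (rule subst_sum_in_ideal[OF ideal_slice pS sub])
      fix v assume v: "v \<in> coords r"
      have "0 \<in> Q r 0"
        using ideal_slice[of r 0] by (simp add: ideal_ring_on_iff)
      then show "var v - (\<phi> v + \<psi> v) \<in> Q r 0"
        using v slice_yz[of r 0]
        by (cases v) (simp_all add: \<phi>_def \<psi>_def half)
    next
      fix u v assume u: "u \<in> coords r" and v: "v \<in> coords r"
      obtain c i where "\<phi> u = c * (var (CX i) + var (CY i))" "c \<in> S" "i \<in> {1..r}"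
      proof -
        have "H \<in> S" "- H \<in> S" by (auto simp: H_def intro!: polys_uminus const_in_polys)
        then show ?thesis using u that[of H] that[of "- H"] by (cases u) (auto simp: \<phi>_def)
      qed
      moreover obtain d j where "\<psi> v = d * (var (CX j) - var (CY j))" "d \<in> S" "j \<in> {1..r}"
      proof -
        have "H \<in> S" "- H \<in> S" by (auto simp: H_def intro!: polys_uminus const_in_polys)
        then show ?thesis using v that[of H] that[of "- H"]
          by (cases v) (auto simp: \<psi>_def algebra_simps)
      qed
      ultimately show "\<phi> u * \<psi> v \<in> Q r 0" by (intro prod')
    qed auto
    ultimately show "p \<in> Q r 0" by simp
  qed
qed

section \<open>The inclusions of \<open>x J\<close> in the slices\<close>

lemma yz_mult_cone_van:
  assumes "1 \<le> m" "Suc m \<le> r" and g: "g \<in> van (coords r) (cone_pts m)"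
  shows "(var (CY (Suc m)) + var (CZ (Suc m))) * g \<in> Q m 0"
proof -
  let ?x = "var (CY (Suc m)) + var (CZ (Suc m)) :: 'k coord_poly"
  define D where "D = {g \<in> S. \<forall>x\<in>{?x}. x * g \<in> Q m 0}"
  define n where "n = Suc m"
  have m: "m \<le> r" "(0::nat) \<le> r" "n \<in> {1..r}" using assms by (auto simp: n_def)
  have xS: "?x \<in> S" using assms by (auto intro!: polys_add var_in_polys)
  have D: "ideal D (ring_on S)"
    unfolding D_def using xS assms by (intro ideal_colon ideal_slice) auto
  have gS: "g \<in> S" using g by (simp add: van_def)
  \<comment> \<open>The quadrics move the linear form to a lower index: for instance
    \<open>(y\<^sub>n + z\<^sub>n) x\<^sub>i\<close> is congruent to
    \<open>x\<^sub>n (y\<^sub>i + z\<^sub>i)\<close>, which lies in the slice as \<open>i\<close> is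
    at most \<open>m\<close>.\<close>
  have low: "var c \<in> D" if i: "i \<in> {1..m}" and c: "c \<in> {CX i, CY i, CZ i}" for i c
  proof -
    have ir: "i \<in> {1..r}" using i m by auto
    note mem = slice_add slice_diff slice_mult slice_van quadrics_vanish slice_yz var_in_polys
    have "(var (CX i) * var (CY n) - var (CX n) * var (CY i))
        + (var (CX i) * var (CZ n) - var (CX n) * var (CZ i))
        + var (CX n) * (var (CY i) + var (CZ i)) \<in> Q m 0"
      using i ir m by (intro mem) auto
    then have X: "?x * var (CX i) \<in> Q m 0" by (simp add: n_def algebra_simps)
    have "(var (CY i) * var (CZ n) - var (CY n) * var (CZ i))
        + var (CY n) * (var (CY i) + var (CZ i)) \<in> Q m 0"
      using i ir m by (intro mem) auto
    then have Y: "?x * var (CY i) \<in> Q m 0" by (simp add: n_def algebra_simps)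
    have "var (CZ n) * (var (CY i) + var (CZ i))
        - (var (CY i) * var (CZ n) - var (CY n) * var (CZ i)) \<in> Q m 0"
      using i ir m by (intro mem) auto
    then have Z: "?x * var (CZ i) \<in> Q m 0" by (simp add: n_def algebra_simps)
    show ?thesis using X Y Z c ir by (auto simp: D_def intro: var_in_polys)
  qed
  \<comment> \<open>Kills the first \<open>m\<close> components. Then \<open>g\<close> splits into
    its truncation and a remainder, and the remainder lies in \<open>D\<close> because the killed
    variables do.\<close>
  define \<phi> :: "coord \<Rightarrow> 'k coord_poly"
    where "\<phi> c = (if \<exists>i\<le>m. c \<in> {CX i, CY i, CZ i} then 0 else var c)" for c
  have \<phi>S: "\<phi> c \<in> S" if "c \<in> coords r" for c
    using that by (auto simp: \<phi>_def polys_0 var_in_polys)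
  have "subst const var g - subst const \<phi> g \<in> D"
  proof (rule subst_diff_in_ideal[OF D gS _ \<phi>S])
    fix c assume c: "c \<in> coords r"
    then show "var c \<in> S" by (rule var_in_polys)
    have "0 \<in> D" using D by (simp add: ideal_ring_on_iff)
    moreover have "var c \<in> D" if "i \<le> m" "c \<in> {CX i, CY i, CZ i}" for i
      using that c by (intro low[of i]) auto
    ultimately show "var c - \<phi> c \<in> D" by (auto simp: \<phi>_def)
  qed
  then have 1: "?x * (g - subst const \<phi> g) \<in> Q m 0"
    by (simp add: D_def subst_const_var)
  \<comment> \<open>Truncating a point of the whole cone gives a point of \<open>cone_pts m\<close>,
    where \<open>g\<close> vanishes.\<close>
  have "subst const \<phi> g \<in> van (coords r) (cone_pts 0)"
  proof -
    have "ev w (subst const \<phi> g) = 0" if "w \<in> cone_pts 0" for w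
    proof -
      obtain s a b where w: "w = pt s a b" using \<open>w \<in> cone_pts 0\<close> by (auto simp: cone_pts_def)
      have "(\<lambda>v. ev w (\<phi> v)) = pt (\<lambda>i. if i \<le> m then 0 else s i) a b"
      proof
        show "ev w (\<phi> v) = pt (\<lambda>i. if i \<le> m then 0 else s i) a b v" for v
          by (cases v) (auto simp: \<phi>_def w id_hom.subst_simps)
      qed
      then have "(\<lambda>v. ev w (\<phi> v)) \<in> cone_pts m" by (simp add: cone_ptsI)
      then show ?thesis using g by (simp add: ev_subst van_def)
    qed
    then show ?thesis using subst_in_polys[OF gS \<phi>S] by (simp add: van_def)
  qed
  then have "?x * subst const \<phi> g \<in> Q m 0"
    using m xS by (intro slice_mult slice_van)
  with 1 have "?x * (g - subst const \<phi> g) + ?x * subst const \<phi> g \<in> Q m 0"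
    using m by (intro slice_add)
  then show ?thesis by (simp add: algebra_simps)
qed

lemma xy_mult_line_van:
  assumes "1 \<le> n" "Suc n \<le> r" and g: "g \<in> van (coords r) (line_pts n 1)"
  shows "(var (CX (Suc n)) + var (CY (Suc n))) * g \<in> Q r n"
proof -
  let ?x = "var (CX (Suc n)) + var (CY (Suc n)) :: 'k coord_poly"
  define D where "D = {g \<in> S. \<forall>x\<in>{?x}. x * g \<in> Q r n}"
  define p where "p = Suc n"
  have n: "n \<le> r" "r \<le> r" "p \<in> {1..r}" using assms by (auto simp: p_def)
  have xS: "?x \<in> S" using assms by (auto intro!: polys_add var_in_polys)
  have D: "ideal D (ring_on S)"
    unfolding D_def using xS assms by (intro ideal_colon ideal_slice) auto
  note mem = slice_add slice_diff slice_mult slice_van quadrics_vanish slice_yz slice_xy var_in_polys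
  have yz: "?x * (var (CY i) + var (CZ i)) \<in> Q r n" if "i \<in> {1..r}" for i
    using that n xS by (intro slice_mult slice_yz)
  \<comment> \<open>Again the minors exchange indices:
    \<open>(x\<^sub>p + y\<^sub>p) x\<^sub>i\<close> is congruent to
    \<open>x\<^sub>p (x\<^sub>i + y\<^sub>i)\<close>, and likewise with \<open>y\<close> as second
    factor.\<close>
  have low: "var c \<in> D" if i: "i \<in> {1..n}" and c: "c \<in> {CX i, CY i, CZ i}" for i c
  proof -
    have ir: "i \<in> {1..r}" using i n by auto
    have "var (CX p) * (var (CX i) + var (CY i))
        + (var (CX i) * var (CY p) - var (CX p) * var (CY i)) \<in> Q r n"
      using i ir n by (intro mem) auto
    then have X: "?x * var (CX i) \<in> Q r n" by (simp add: p_def algebra_simps)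
    have "var (CY p) * (var (CX i) + var (CY i))
        - (var (CX i) * var (CY p) - var (CX p) * var (CY i)) \<in> Q r n"
      using i ir n by (intro mem) auto
    then have Y: "?x * var (CY i) \<in> Q r n" by (simp add: p_def algebra_simps)
    have "?x * (var (CY i) + var (CZ i)) - ?x * var (CY i) \<in> Q r n"
      using n by (intro slice_diff yz Y ir)
    then have Z: "?x * var (CZ i) \<in> Q r n" by (simp add: algebra_simps)
    show ?thesis using X Y Z c ir by (auto simp: D_def intro: var_in_polys)
  qed
  \<comment> \<open>The factorisation from \<open>slice_yz_van\<close> once more, with first factor
    at index \<open>p\<close>.\<close>
  have high: "var (CX j) - var (CY j) \<in> D" "var (CY j) + var (CZ j) \<in> D" if j: "j \<in> {n+1..r}" for j
  proof -
    have jr: "j \<in> {1..r}" using j by auto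
    have "((var (CX p) * var (CX j) + var (CY p) * var (CZ j))
        - (var (CX p) * var (CY j) - var (CX j) * var (CY p)))
        - var (CY p) * (var (CY j) + var (CZ j)) \<in> Q r n"
      using jr n by (intro mem) auto
    then have "?x * (var (CX j) - var (CY j)) \<in> Q r n" by (simp add: p_def algebra_simps)
    then show "var (CX j) - var (CY j) \<in> D" "var (CY j) + var (CZ j) \<in> D"
      using jr yz[OF jr] by (auto simp: D_def intro!: polys_diff polys_add var_in_polys)
  qed
  have "P_gens r n \<subseteq> D"
    unfolding P_gens_def using low high by blast
  then have "genideal (ring_on S) (P_gens r n) \<subseteq> D"
    by (rule genideal_minimal[OF D])
  then show ?thesis
    using g n(1) by (auto simp: P_gens_van D_def)
qed

section \<open>Cancellation modulo the vanishing ideals \<open>J\<close>\<close>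

lemma yz_cancel_cone_van:
  assumes "y \<in> S" "(var (CY (Suc m)) + var (CZ (Suc m))) * y \<in> van (coords r) (cone_pts m)"
  shows "y \<in> van (coords r) (cone_pts m)"
proof (rule van_cancel[OF inf _ assms])
  fix w :: "coord \<Rightarrow> 'k" assume "w \<in> cone_pts m"
  then obtain s a b where w: "w = pt s a b" "\<forall>i\<le>m. s i = 0" by (auto simp: cone_pts_def)
  \<comment> \<open>The curve moves both \<open>s (Suc m)\<close> and \<open>a\<close>: moving only
    the former fails where \<open>a * a = b * b\<close>, moving only the latter where
    \<open>s (Suc m) = 0\<close>. Together they turn \<open>y + z\<close> into a product of three
    monic linear factors.\<close>
  define s' where "s' i = (if i = Suc m then [:s i, 1:] else [:s i:])" for i
  define \<gamma> where "\<gamma> = pt s' [:a, 1:] [:b:]"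
  have poly_\<gamma>: "(\<lambda>v. poly (\<gamma> v) t) = pt (\<lambda>i. poly (s' i) t) (a + t) b" for t
  proof
    show "poly (\<gamma> v) t = pt (\<lambda>i. poly (s' i) t) (a + t) b v" for v
      by (cases v) (simp_all add: \<gamma>_def algebra_simps)
  qed
  have "(\<lambda>v. poly (\<gamma> v) t) \<in> cone_pts m" for t
    unfolding poly_\<gamma> using w(2) by (intro cone_ptsI) (auto simp: s'_def)
  moreover have "poly (\<gamma> v) 0 = w v" for v
  proof -
    have "(\<lambda>i. poly (s' i) 0) = s" by (auto simp: s'_def)
    then show ?thesis using fun_cong[OF poly_\<gamma>[of 0], of v] by (simp add: w(1))
  qed
  moreover have "subst (\<lambda>x. [:x:]) \<gamma> (var (CY (Suc m)) + var (CZ (Suc m))) \<noteq> 0"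
  proof -
    have "subst (\<lambda>x. [:x:]) \<gamma> (var (CY (Suc m)) + var (CZ (Suc m)))
        = [:s (Suc m), 1:] * [:a - b, 1:] * [:a + b, 1:]"
      by (simp add: pCons_hom.subst_simps \<gamma>_def s'_def algebra_simps)
    then show ?thesis by (simp only: mult_eq_0_iff) simp
  qed
  ultimately show "\<exists>\<gamma>. (\<forall>t. (\<lambda>v. poly (\<gamma> v) t) \<in> cone_pts m) \<and> (\<forall>v. poly (\<gamma> v) 0 = w v)
      \<and> subst (\<lambda>x. [:x:]) \<gamma> (var (CY (Suc m)) + var (CZ (Suc m))) \<noteq> 0" by blast
qed

lemma xy_cancel_line_van:
  assumes two: "(2 :: 'k) \<noteq> 0"
    and "y \<in> S" "(var (CX (Suc n)) + var (CY (Suc n))) * y \<in> van (coords r) (line_pts n 1)"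
  shows "y \<in> van (coords r) (line_pts n 1)"
proof (rule van_cancel[OF inf _ assms(2,3)])
  fix w :: "coord \<Rightarrow> 'k" assume "w \<in> line_pts n 1"
  then obtain s where w: "w = pt s 1 1" "\<forall>i\<le>n. s i = 0" by (auto simp: line_pts_def)
  \<comment> \<open>On this space \<open>x + y\<close> is twice the parameter, so moving the
    parameter at \<open>Suc n\<close> gives a nonzero restriction when 2 is nonzero.\<close>
  define s' where "s' i = (if i = Suc n then [:s i, 1:] else [:s i:])" for i
  define \<gamma> where "\<gamma> = pt s' 1 1"
  have poly_\<gamma>: "(\<lambda>v. poly (\<gamma> v) t) = pt (\<lambda>i. poly (s' i) t) 1 1" for t
  proof
    show "poly (\<gamma> v) t = pt (\<lambda>i. poly (s' i) t) 1 1 v" for v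
      by (cases v) (auto simp: \<gamma>_def)
  qed
  have "(\<lambda>v. poly (\<gamma> v) t) \<in> line_pts n 1" for t
    unfolding poly_\<gamma> using w(2) by (intro line_ptsI) (auto simp: s'_def)
  moreover have "poly (\<gamma> v) 0 = w v" for v
  proof -
    have "(\<lambda>i. poly (s' i) 0) = s" by (auto simp: s'_def)
    then show ?thesis using fun_cong[OF poly_\<gamma>[of 0], of v] by (simp add: w(1))
  qed
  moreover have "subst (\<lambda>x. [:x:]) \<gamma> (var (CX (Suc n)) + var (CY (Suc n))) \<noteq> 0"
    using two by (simp add: pCons_hom.subst_simps \<gamma>_def s'_def)
  ultimately show "\<exists>\<gamma>. (\<forall>t. (\<lambda>v. poly (\<gamma> v) t) \<in> line_pts n 1) \<and> (\<forall>v. poly (\<gamma> v) 0 = w v)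
      \<and> subst (\<lambda>x. [:x:]) \<gamma> (var (CX (Suc n)) + var (CY (Suc n))) \<noteq> 0" by blast
qed

section \<open>Strictness of the inclusions in \<open>J\<close>\<close>

lemma slice_yz_psubset:
  assumes "1 \<le> m" "m \<le> r"
  shows "Q m 0 \<subset> van (coords r) (cone_pts m)"
proof
  show "Q m 0 \<subseteq> van (coords r) (cone_pts m)"
    using assms by (intro slice_subset_van) (auto simp: cone_pts_def)
  \<comment> \<open>A point with \<open>x = y = 1\<close> and \<open>z = -1\<close> in every
    component satisfies the slice equations, yet \<open>x\<^sub>1\<close> is nonzero there;
    \<open>x\<^sub>1\<close> vanishes on \<open>cone_pts m\<close> as \<open>m\<close> is at least
    1.\<close>
  have "Q m 0 \<subseteq> van (coords r) {pt (\<lambda>i. if i = 0 then 0 else 1) 1 1}"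
    using assms by (intro slice_subset_van) (auto intro: cone_ptsI)
  moreover have "var (CX 1) \<notin> van (coords r) {pt (\<lambda>i. if i = 0 then 0 else 1 :: 'k) 1 1}"
    by (simp add: van_def id_hom.subst_simps)
  moreover have "var (CX 1) \<in> van (coords r) (cone_pts m)"
    using assms by (auto simp: van_def cone_pts_def id_hom.subst_simps intro: var_in_polys)
  ultimately show "Q m 0 \<noteq> van (coords r) (cone_pts m)" by blast
qed

lemma slice_xy_psubset:
  assumes "1 \<le> n" "n \<le> r"
  shows "Q r n \<subset> van (coords r) (line_pts n 1)"
proof
  show "Q r n \<subseteq> van (coords r) (line_pts n 1)"
    using assms by (intro slice_subset_van line_pts_subset_cone_pts) (auto simp: line_pts_def)
  \<comment> \<open>The separating point now comes from the other linear space, where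
    \<open>x + y\<close> is zero.\<close>
  have "Q r n \<subseteq> van (coords r) {pt (\<lambda>i. if i = 0 then 0 else 1) 1 (-1)}"
    using assms by (intro slice_subset_van) (auto intro: cone_ptsI)
  moreover have "var (CX 1) \<notin> van (coords r) {pt (\<lambda>i. if i = 0 then 0 else 1 :: 'k) 1 (-1)}"
    by (simp add: van_def id_hom.subst_simps)
  moreover have "var (CX 1) \<in> van (coords r) (line_pts n 1)"
    using assms by (auto simp: van_def line_pts_def id_hom.subst_simps intro: var_in_polys)
  ultimately show "Q r n \<noteq> van (coords r) (line_pts n 1)" by blast
qed

section \<open>Matching the stated family with slices and vanishing ideals\<close>

lemma slice_eqs:
  assumes "m \<le> r" "n \<le> r"
  shows "van (coords r) (cone_pts 0) <+>\<^bsub>ring_on S\<^esub>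
      ideal_sum (ring_on S) {1..m} (\<lambda>i. genideal (ring_on S) {var (CY i) + var (CZ i)}) = Q m 0"
    and "Q m 0 <+>\<^bsub>ring_on S\<^esub>
      ideal_sum (ring_on S) {1..n} (\<lambda>j. genideal (ring_on S) {var (CX j) + var (CY j)}) = Q m n"
proof -
  let ?R = "ring_on S" and ?V = "van (coords r) (cone_pts 0) :: 'k coord_poly set"
  let ?Y = "\<Union>i\<in>{1..m}. {var (CY i) + var (CZ i)} :: 'k coord_poly set"
  let ?X = "\<Union>j\<in>{1..n}. {var (CX j) + var (CY j)} :: 'k coord_poly set"
  have sub: "?V \<subseteq> carrier ?R" "?Y \<subseteq> carrier ?R" "?X \<subseteq> carrier ?R"
    using assms by (auto simp: van_def intro!: polys_add var_in_polys)
  have V: "genideal ?R ?V = ?V" by (rule genideal_ideal_eq[OF ideal_van])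
  have sums: "ideal_sum ?R {1..m} (\<lambda>i. genideal ?R {var (CY i) + var (CZ i)}) = genideal ?R ?Y"
    "ideal_sum ?R {1..n} (\<lambda>j. genideal ?R {var (CX j) + var (CY j)}) = genideal ?R ?X"
    by (intro ideal_sum_genideal; use sub in blast)+
  have gens: "slice_gens r m 0 = ?V \<union> ?Y" "slice_gens r m n = (?V \<union> ?Y) \<union> ?X"
    by (auto simp: slice_gens_def)
  show "?V <+>\<^bsub>?R\<^esub> ideal_sum ?R {1..m} (\<lambda>i. genideal ?R {var (CY i) + var (CZ i)}) = Q m 0"
    using genideal_add[OF sub(1,2)] by (simp only: V sums slice_def gens)
  show "Q m 0 <+>\<^bsub>?R\<^esub> ideal_sum ?R {1..n} (\<lambda>j. genideal ?R {var (CX j) + var (CY j)}) = Q m n"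
    using genideal_add[OF Un_least[OF sub(1,2)] sub(3)] by (simp only: sums slice_def gens)
qed

lemma P_ideal_van:
  assumes "m \<le> r"
  shows "P_ideal r m = (van (coords r) (line_pts m 1) :: 'k coord_poly set)"
proof -
  let ?R = "ring_on S"
  let ?A = "\<Union>i\<in>{1..m}. {var (CX i), var (CY i), var (CZ i)} :: 'k coord_poly set"
  let ?B = "\<Union>j\<in>{m+1..r}. {var (CX j) - var (CY j), var (CY j) + var (CZ j)} :: 'k coord_poly set"
  have sub: "?A \<subseteq> carrier ?R" "?B \<subseteq> carrier ?R"
    using P_gens_subset[OF assms] by (simp_all add: P_gens_def)
  have "P_ideal r m = genideal ?R ?A <+>\<^bsub>?R\<^esub> genideal ?R ?B"
    unfolding P_ideal_def coord_ring_eq coord_var_eq using sub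
    by (subst (1 2) ideal_sum_genideal) (auto simp only: ring_on_simps UN_subset_iff)
  also have "\<dots> = genideal ?R (P_gens r m)"
    unfolding P_gens_def by (rule genideal_add[OF sub])
  finally show ?thesis by (simp add: P_gens_van[OF assms])
qed

text \<open>The maximal ideal is the case \<open>m = r\<close> of \<open>P_gens\<close>, where the
  second union is empty.\<close>

lemma irrelevant_ideal_van: "irrelevant_ideal r = (van (coords r) (line_pts r 1) :: 'k coord_poly set)"
proof -
  have "irrelevant_ideal r = genideal (ring_on S) (P_gens r r)"
    by (simp add: irrelevant_ideal_def coord_ring_eq coord_var_eq P_gens_def)
  then show ?thesis by (simp add: P_gens_van)
qed

end

section \<open>Checking the family member by member\<close>

theorem proposition5p2p6:
  fixes r :: nat and R :: "'k::alg_closed_field coord_poly ring"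
  assumes "CHAR('k) \<noteq> 2" and "r \<ge> 1" and R: "R = coord_ring r"
  shows "principal_radical_system R
    ( {I_ideal r j | j. j \<in> {1..r}}
    \<union> {P_ideal r j | j. j \<in> {1..r}}
    \<union> {I_ideal r r <+>\<^bsub>R\<^esub> ideal_sum R {1..m} (\<lambda>i. Idl\<^bsub>R\<^esub> {y_var i + z_var i})
        | m. m \<in> {1..r}}
    \<union> {(I_ideal r r <+>\<^bsub>R\<^esub> ideal_sum R {1..r} (\<lambda>i. Idl\<^bsub>R\<^esub> {y_var i + z_var i}))
          <+>\<^bsub>R\<^esub> ideal_sum R {1..n} (\<lambda>j. Idl\<^bsub>R\<^esub> {x_var j + y_var j})
        | n. n \<in> {1..r}}
    \<union> {irrelevant_ideal r})"
    (is "principal_radical_system R ?F")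
proof -
  interpret coord_polys r "TYPE('k)" .
  have two: "(2 :: 'k) \<noteq> 0" by (rule two_neq_0[OF assms(1)])
  have RS: "R = ring_on S" by (simp add: R coord_ring_eq)
  have I_eq: "I_ideal r j = (van (coords r) (cone_pts (r - j)) :: 'k coord_poly set)" if "j \<le> r" for j
    by (rule I_ideal_eq[OF assms(1) that])
  define G where "G = {van (coords r) (cone_pts (r - j)) | j. j \<in> {1..r}}
      \<union> {van (coords r) (line_pts j 1) | j. j \<in> {1..r}}
      \<union> {Q m 0 | m. m \<in> {1..r}} \<union> {Q r n | n. n \<in> {1..r}} \<union> {van (coords r) (line_pts r 1)}"
  have F: "?F = G"
    unfolding RS coord_var_eq irrelevant_ideal_van G_def setcompr_eq_image
    by (intro arg_cong2[of _ _ _ _ "(\<union>)"] image_cong refl)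
       (simp_all add: I_eq P_ideal_van slice_eqs(1)[where n = r] slice_eqs(2) del: One_nat_def)
  \<comment> \<open>Alternative (b)(ii), with the ring operations unfolded.\<close>
  define step where "step I \<longleftrightarrow> (\<exists>x\<in>S. I <+>\<^bsub>ring_on S\<^esub> PIdl\<^bsub>ring_on S\<^esub> x \<in> G \<and>
      (\<exists>J\<in>G. I \<subset> J \<and> (\<forall>a\<in>J. x * a \<in> I) \<and>
         non_zero_divisor (ring_on S Quot radical (ring_on S) J)
           (radical (ring_on S) J +>\<^bsub>ring_on S\<^esub> x)))" for I
  have van_case: "radical_ideal (ring_on S) (van (coords r) W)" for W :: "(coord \<Rightarrow> 'k) set"
    by (rule radical_ideal_van)
  have nzd: "non_zero_divisor (ring_on S Quot radical (ring_on S) (van (coords r) W))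
       (radical (ring_on S) (van (coords r) W) +>\<^bsub>ring_on S\<^esub> x)"
    if "x \<in> S" "\<And>y. y \<in> S \<Longrightarrow> x * y \<in> van (coords r) W \<Longrightarrow> y \<in> van (coords r) W"
    for x and W :: "(coord \<Rightarrow> 'k) set"
  proof -
    have "radical (ring_on S) (van (coords r) W) = van (coords r) W"
      using van_case[of W] by (simp add: radical_ideal_def)
    then show ?thesis
      using non_zero_divisor_QuotI[OF ideal_van, of x] that by simp
  qed
  have yz_case: "radical_ideal (ring_on S) (Q m 0) \<or> step (Q m 0)" if m: "m \<in> {1..r}" for m
  proof (cases "m = r")
    case True
    then show ?thesis using slice_yz_van[OF two] van_case by simp
  next
    case False
    with m have m': "1 \<le> m" "Suc m \<le> r" by auto
    let ?x = "var (CY (Suc m)) + var (CZ (Suc m)) :: 'k coord_poly"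
    let ?J = "van (coords r) (cone_pts m) :: 'k coord_poly set"
    have x: "?x \<in> S" using m' by (auto intro!: polys_add var_in_polys)
    \<comment> \<open>Adjoining \<open>?x\<close> leads to the next slice, still in the family as
      \<open>m\<close> is less than \<open>r\<close>.\<close>
    have "Q m 0 <+>\<^bsub>ring_on S\<^esub> PIdl\<^bsub>ring_on S\<^esub> ?x \<in> G"
      using slice_Suc_yz[of m 0] m' by (auto simp: G_def)
    \<comment> \<open>\<open>?J\<close> is the ideal \<open>I_ideal r (r - m)\<close>, and
      \<open>r - m\<close> is at least 1.\<close>
    moreover have "?J \<in> G"
    proof -
      have "?J = van (coords r) (cone_pts (r - (r - m)))" "r - m \<in> {1..r}" using m' by auto
      then show ?thesis unfolding G_def by blast
    qed
    moreover have "Q m 0 \<subset> ?J" using m' by (intro slice_yz_psubset) auto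
    moreover have "\<forall>a\<in>?J. ?x * a \<in> Q m 0" using yz_mult_cone_van[OF m'] by blast
    moreover have "non_zero_divisor (ring_on S Quot radical (ring_on S) ?J) (radical (ring_on S) ?J +>\<^bsub>ring_on S\<^esub> ?x)"
      by (rule nzd[OF x yz_cancel_cone_van])
    ultimately have "step (Q m 0)" using x unfolding step_def by blast
    then show ?thesis ..
  qed
  have xy_case: "radical_ideal (ring_on S) (Q r n) \<or> step (Q r n)" if n: "n \<in> {1..r}" for n
  proof (cases "n = r")
    case True
    then show ?thesis using slice_full_van van_case by simp
  next
    case False
    with n have n': "1 \<le> n" "Suc n \<le> r" by auto
    let ?x = "var (CX (Suc n)) + var (CY (Suc n)) :: 'k coord_poly"
    let ?J = "van (coords r) (line_pts n 1) :: 'k coord_poly set"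
    have x: "?x \<in> S" using n' by (auto intro!: polys_add var_in_polys)
    have "Q r n <+>\<^bsub>ring_on S\<^esub> PIdl\<^bsub>ring_on S\<^esub> ?x \<in> G"
      using slice_Suc_xy[of r n] n' by (auto simp: G_def)
    moreover have "?J \<in> G" using n unfolding G_def by blast
    moreover have "Q r n \<subset> ?J" using n' by (intro slice_xy_psubset) auto
    moreover have "\<forall>a\<in>?J. ?x * a \<in> Q r n" using xy_mult_line_van[OF n'] by blast
    moreover have "non_zero_divisor (ring_on S Quot radical (ring_on S) ?J) (radical (ring_on S) ?J +>\<^bsub>ring_on S\<^esub> ?x)"
      by (rule nzd[OF x xy_cancel_line_van[OF two]])
    ultimately have "step (Q r n)" using x unfolding step_def by blast
    then show ?thesis ..
  qed
  have cases: "radical_ideal (ring_on S) I \<or> step I" if "I \<in> G" for I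
    using that van_case yz_case xy_case unfolding G_def by blast
  have ideals: "ideal I (ring_on S)" if "I \<in> G" for I
    using that ideal_van by (auto simp: G_def intro!: ideal_slice)
  show ?thesis
    unfolding F unfolding RS principal_radical_system_def
  proof (intro conjI ballI)
    show "cring (ring_on S)" by (rule is_cring)
    show "noetherian_ring (ring_on S)" by (rule noetherian_polys[OF finite_coords])
    fix I assume I: "I \<in> G"
    then show "ideal I (ring_on S)" by (rule ideals)
    show "radical_ideal (ring_on S) I \<or> (\<exists>x\<in>carrier (ring_on S).
        I <+>\<^bsub>ring_on S\<^esub> PIdl\<^bsub>ring_on S\<^esub> x \<in> G \<and>
        (non_zero_divisor (ring_on S Quot radical (ring_on S) I)
            (radical (ring_on S) I +>\<^bsub>ring_on S\<^esub> x) \<and>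
          (\<Inter>i::nat. (\<lambda>a. I +>\<^bsub>ring_on S\<^esub> a) `
            (I <+>\<^bsub>ring_on S\<^esub> PIdl\<^bsub>ring_on S\<^esub> (x [^]\<^bsub>ring_on S\<^esub> i))) = {\<zero>\<^bsub>ring_on S Quot I\<^esub>} \<or>
        (\<exists>J\<in>G. I \<subset> J \<and> (\<forall>a\<in>J. x \<otimes>\<^bsub>ring_on S\<^esub> a \<in> I) \<and>
          non_zero_divisor (ring_on S Quot radical (ring_on S) J)
            (radical (ring_on S) J +>\<^bsub>ring_on S\<^esub> x))))"
      using cases[OF I] unfolding step_def ring_on_simps by blast
  qed
qed

end
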